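(* Let $f\in\mathbb{C}[z]$ be a polynomial of degree $m\ge 1$, let $g\in\mathbb{C}[z]$ be a polynomial (of any degree), and let $C(t)=\sum_{i=1}^m n_i z_i(t)$ be a zero cycle of $f$. The deformation $f+\epsilon g=t$ has an infinitesimal center for the cycle $C$, i.e. its displacement function along $C$ satisfies $\Delta(t,\epsilon)\equiv 0$ for all $t$ and all $\epsilon$ small enough, if and only if $f,g,C$ satisfy the composition condition.
   Context: Zero cycle: for $f\in\mathbb{C}[z]$ of degree $m\ge1$, a zero cycle $C$ of $f$ is a multivalued function given by a formal sum $C(t)=\sum_{i=1}^m n_i z_i(t)$, where $z_1(t),\dots,z_m(t)$ are the roots of $f(z)=t$ (multivalued analytic functions of $t$), and the weights $n_i\in\mathbb{Z}$ satisfy $\sum_{i=1}^m n_i=0$. The variable $t$ is always restricted to non-critical values of $f$. Deformed cycle: given $g\in\mathbb{C}[z]$ and $\epsilon$ small, $z_i(t,\epsilon)$, $i=1,\dots,m$, are the multivalued analytic functions determined by $(f+\epsilon g)(z_i(t,\epsilon))=t$ and $z_i(t,0)=z_i(t)$; the induced cycle is the formal sum $C_\epsilon(t)=\sum_{i=1}^m n_i z_i(t,\epsilon)$. Displacement function of the deformation $f(z)+\epsilon g(z)=t$ along $C$: $\Delta(t,\epsilon)=\int_{C_\epsilon(t)} f:=\sum_{i=1}^m n_i f(z_i(t,\epsilon))$. Composition condition: $f,g$ and the cycle $C$ of $f$ satisfy the composition condition if there exist polynomials $\tilde f,\tilde g,h\in\mathbb{C}[z]$ such that $f(z)=\tilde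 f(h(z))$, $g(z)=\tilde g(h(z))$, and for every $\epsilon$ the perturbed cycle $C_\epsilon$ projected by $h$ is trivial, that is, for every $i=1,\dots,m$, $$\sum_{j\,:\,h(z_j(t,\epsilon))=h(z_i(t,\epsilon))} n_j=0,$$ where $j$ ranges over $1,\dots,m$ and equality of $h(z_j(t,\epsilon))$ and $h(z_i(t,\epsilon))$ is as functions. *)

theory Defs
  imports "HOL-Complex_Analysis.Complex_Analysis"
begin

definition critical_values :: "complex poly \<Rightarrow> complex set" where
  "critical_values f = poly f ` {c. poly (pderiv f) c = 0}"

text \<open>
  The multivalued roots \<open>z\<^sub>1, \<dots>, z\<^sub>m\<close> of \<open>f z = t\<close> are represented by a
  non-critical base value \<open>t0\<close> together with an enumeration \<open>a 1, \<dots>, a m\<close> of the roots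
  of \<open>f z = t0\<close>; everything else is obtained from it by analytic continuation. A zero cycle
  is given by \<open>t0\<close>, \<open>a\<close> and the weights \<open>n\<close>.
\<close>

definition zero_cycle :: "complex poly \<Rightarrow> complex \<Rightarrow> (nat \<Rightarrow> complex) \<Rightarrow> (nat \<Rightarrow> int) \<Rightarrow> bool" where
  "zero_cycle f t0 a n \<longleftrightarrow>
     t0 \<notin> critical_values f \<and>
     bij_betw a {1..degree f} {w. poly f w = t0} \<and>
     (\<Sum>i=1..degree f. n i) = 0"

text \<open>
  \<open>z\<close> is a simultaneous determination, single-valued on the domain \<open>U\<close>, of the multivalued
  functions \<open>z\<^sub>1, \<dots>, z\<^sub>m\<close>. The labels are transported from the base value along a path
  \<open>\<gamma>\<close>: away from the critical values, analytic continuation of a root along \<open>\<gamma>\<close> is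
  the same as lifting \<open>\<gamma>\<close> through \<open>f\<close>. All \<open>m\<close> roots are continued along the
  same \<open>\<gamma>\<close>.
\<close>

definition root_branches ::
  "complex poly \<Rightarrow> complex \<Rightarrow> (nat \<Rightarrow> complex) \<Rightarrow> complex set \<Rightarrow> (nat \<Rightarrow> complex \<Rightarrow> complex) \<Rightarrow> bool" where
  "root_branches f t0 a U z \<longleftrightarrow>
     open U \<and> connected U \<and> U \<inter> critical_values f = {} \<and>
     (\<forall>i\<in>{1..degree f}. z i holomorphic_on U \<and> (\<forall>t\<in>U. poly f (z i t) = t)) \<and>
     (\<exists>\<gamma> \<zeta>. path \<gamma> \<and> path_image \<gamma> \<inter> critical_values f = {} \<and>
        pathstart \<gamma> = t0 \<and> pathfinish \<gamma> \<in> U \<and>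
        (\<forall>i\<in>{1..degree f}. path (\<zeta> i) \<and> (\<forall>s\<in>{0..1}. poly f (\<zeta> i s) = \<gamma> s) \<and>
           pathstart (\<zeta> i) = a i \<and> pathfinish (\<zeta> i) = z i (pathfinish \<gamma>)))"

text \<open>
  Joint analyticity in two complex variables; by Osgood's lemma it amounts to continuity
  together with holomorphy in each variable separately.
\<close>

definition analytic2_on :: "(complex \<Rightarrow> complex \<Rightarrow> complex) \<Rightarrow> complex set \<Rightarrow> complex set \<Rightarrow> bool" where
  "analytic2_on F U V \<longleftrightarrow>
     continuous_on (U \<times> V) (\<lambda>(t, \<epsilon>). F t \<epsilon>) \<and>
     (\<forall>\<epsilon>\<in>V. (\<lambda>t. F t \<epsilon>) holomorphic_on U) \<and>
     (\<forall>t\<in>U. (\<lambda>\<epsilon>. F t \<epsilon>) holomorphic_on V)"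

text \<open>
  \<open>Z i t \<epsilon>\<close> is a determination of \<open>z\<^sub>i(t, \<epsilon>)\<close> for \<open>t \<in> U\<close> and \<open>\<bar>\<epsilon>\<bar> < \<delta>\<close>.
  Such determinations exist near \<open>(t, 0)\<close> for every non-critical \<open>t\<close>, by the implicit
  function theorem, and are unique given \<open>Z i t 0\<close>. If \<open>degree g > degree f\<close>, the additional
  roots of \<open>f + \<epsilon> g = t\<close> (which escape to infinity as \<open>\<epsilon>\<close> tends to 0) play no role.
\<close>

definition deformed_branches ::
  "complex poly \<Rightarrow> complex poly \<Rightarrow> complex \<Rightarrow> (nat \<Rightarrow> complex) \<Rightarrow> complex set \<Rightarrow> real \<Rightarrow>
     (nat \<Rightarrow> complex \<Rightarrow> complex \<Rightarrow> complex) \<Rightarrow> bool" where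
  "deformed_branches f g t0 a U \<delta> Z \<longleftrightarrow>
     \<delta> > 0 \<and> root_branches f t0 a U (\<lambda>i t. Z i t 0) \<and>
     (\<forall>i\<in>{1..degree f}. analytic2_on (Z i) U (ball 0 \<delta>) \<and>
        (\<forall>t\<in>U. \<forall>\<epsilon>\<in>ball 0 \<delta>. poly (f + smult \<epsilon> g) (Z i t \<epsilon>) = t))"

definition displacement ::
  "complex poly \<Rightarrow> (nat \<Rightarrow> int) \<Rightarrow> (nat \<Rightarrow> complex \<Rightarrow> complex \<Rightarrow> complex) \<Rightarrow>
     complex \<Rightarrow> complex \<Rightarrow> complex" where
  "displacement f n Z t \<epsilon> = (\<Sum>i=1..degree f. of_int (n i) * poly f (Z i t \<epsilon>))"

definition infinitesimal_center ::
  "complex poly \<Rightarrow> complex poly \<Rightarrow> complex \<Rightarrow> (nat \<Rightarrow> complex) \<Rightarrow> (nat \<Rightarrow> int) \<Rightarrow> bool" where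
  "infinitesimal_center f g t0 a n \<longleftrightarrow>
     (\<forall>U \<delta> Z. deformed_branches f g t0 a U \<delta> Z \<longrightarrow>
        (\<forall>t\<in>U. \<forall>\<epsilon>\<in>ball 0 \<delta>. displacement f n Z t \<epsilon> = 0))"

definition composition_condition ::
  "complex poly \<Rightarrow> complex poly \<Rightarrow> complex \<Rightarrow> (nat \<Rightarrow> complex) \<Rightarrow> (nat \<Rightarrow> int) \<Rightarrow> bool" where
  "composition_condition f g t0 a n \<longleftrightarrow>
     (\<exists>f' g' h. f = pcompose f' h \<and> g = pcompose g' h \<and>
        (\<forall>U \<delta> Z. deformed_branches f g t0 a U \<delta> Z \<longrightarrow>
           (\<forall>\<epsilon>\<in>ball 0 \<delta>. \<forall>i\<in>{1..degree f}.
              (\<Sum>j | j \<in> {1..degree f} \<and> (\<forall>t\<in>U. poly h (Z j t \<epsilon>) = poly h (Z i t \<epsilon>)). n j) = 0)))"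

end

theory Submission
  imports Defs "HOL-Computational_Algebra.Fundamental_Theorem_Algebra"
begin

text \<open>
  Let \<open>A\<^sub>k(t, \<epsilon>) = \<Sum>\<^sub>i n\<^sub>i g(z\<^sub>i(t, \<epsilon>))\<^sup>k\<close>. Since \<open>f(z\<^sub>i) = t - \<epsilon> g(z\<^sub>i)\<close> and the weights sum
  to zero, a vanishing displacement means \<open>A\<^sub>1 = 0\<close>. Differentiating \<open>(f + \<epsilon> g)(z\<^sub>i(t, \<epsilon>)) = t\<close>
  in both variables gives \<open>\<partial>\<^sub>\<epsilon> z\<^sub>i = - g(z\<^sub>i) \<partial>\<^sub>t z\<^sub>i\<close>, and hence
  \<open>\<partial>\<^sub>\<epsilon> A\<^sub>k = - k / (k + 1) \<partial>\<^sub>t A\<^bsub>k+1\<^esub>\<close>. So once \<open>A\<^sub>k\<close> vanishes identically,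
  \<open>A\<^bsub>k+1\<^esub>\<close> does not depend on \<open>t\<close>, and it is the value of a relation
  \<open>\<Sum>\<^sub>i n\<^sub>i G(z\<^sub>i(t)) = c\<close> between branches of the inverse of the single polynomial
  \<open>f + \<epsilon> g\<close>. The monodromy of such an inverse is transitive: near infinity its branches are permuted
  cyclically. Averaging the relation over this cyclic group replaces every \<open>G(z\<^sub>i(t))\<close> by the same
  quantity, and \<open>\<Sum>\<^sub>i n\<^sub>i = 0\<close> leaves \<open>c = 0\<close>; this is
  \<open>constant_weighted_sum_of_branches_eq_0\<close>. By induction every \<open>A\<^sub>k\<close> vanishes
  (\<open>power_sums_eq_0_if_displacement_eq_0\<close>), so by interpolation the weights of the branches on which
  \<open>g\<close> takes a given value sum to zero.
  
  It remains to pass from \<open>g\<close> to a common right factor \<open>h\<close> of \<open>f\<close> and \<open>g\<close> with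
  \<open>h(z\<^sub>i) = h(z\<^sub>j)\<close> whenever \<open>g(z\<^sub>i) = g(z\<^sub>j)\<close>. Branches on which \<open>g\<close> agrees
  at a point \<open>(t, \<epsilon>)\<close> also agree under \<open>f\<close>, so \<open>h\<close> should generate the field
  \<open>\<complex>(f, g)\<close>; such an \<open>h\<close> exists by the theorem of Lueroth. The version needed is
  \<open>common_right_factor\<close>: up to sign and for almost all \<open>z\<close>, \<open>h(z)\<close> is the product of all \<open>x\<close> with
  \<open>f(x) = f(z)\<close> and \<open>g(x) = g(z)\<close>.
  
  Conversely, if \<open>f\<close> factors through \<open>h\<close> and the cycle projected by \<open>h\<close> is trivial, the
  displacement vanishes after collecting the terms with equal \<open>h(z\<^sub>i)\<close>.
\<close>

section \<open>Fibres of a polynomial\<close>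

lemma holomorphic_on_poly [holomorphic_intros]:
  fixes p :: "complex poly"
  assumes "f holomorphic_on A"
  shows "(\<lambda>x. poly p (f x)) holomorphic_on A"
  by (induction p) (auto intro!: holomorphic_intros assms)

lemma degree_diff_const:
  fixes p :: "complex poly"
  shows "degree (p - [:c:]) = degree p"
  by (cases "degree p = 0")
    (auto elim: degree_eq_zeroE simp: degree_add_eq_left diff_conv_add_uminus simp del: add_uminus_conv_diff)

lemma surj_poly:
  fixes F :: "complex poly"
  assumes "degree F \<ge> 1"
  shows "surj (poly F)"
proof -
  have "\<exists>x. poly F x = y" for y
  proof -
    have "\<not> constant (poly (F - [:y:]))"
      using assms by (simp add: constant_degree degree_diff_const)
    from fundamental_theorem_of_algebra[OF this] show ?thesis by auto
  qed
  then show ?thesis by (metis surjI)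
qed

lemma rsquarefree_card_roots:
  fixes p :: "complex poly"
  assumes "rsquarefree p"
  shows "card {z. poly p z = 0} = degree p"
proof -
  have "p \<noteq> 0"
    using assms by (simp add: rsquarefree_def)
  have "degree p = degree (\<Prod>z|poly p z = 0. [:-z, 1:])"
    using complex_poly_decompose_rsquarefree[OF assms] \<open>p \<noteq> 0\<close>
    by (metis degree_smult_eq leading_coeff_0_iff)
  also have "\<dots> = card {z. poly p z = 0}"
    by (subst degree_prod_sum_eq) auto
  finally show ?thesis ..
qed

lemma finite_critical_values:
  assumes "degree F \<ge> 1"
  shows "finite (critical_values F)"
proof -
  have "pderiv F \<noteq> 0"
    using assms by (simp add: pderiv_eq_0_iff)
  then show ?thesis
    unfolding critical_values_def using poly_roots_finite by blast
qed

lemma finite_fibre: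
  fixes F :: "complex poly"
  assumes "degree F \<ge> 1"
  shows "finite {x. poly F x = t}"
proof -
  have "F - [:t:] \<noteq> 0"
    using assms by auto
  then have "finite {x. poly (F - [:t:]) x = 0}"
    by (rule poly_roots_finite)
  then show ?thesis by simp
qed

lemma rsquarefree_fibre:
  fixes F :: "complex poly"
  assumes "t \<notin> critical_values F"
  shows "rsquarefree (F - [:t:])"
  using assms by (auto simp: rsquarefree_roots critical_values_def pderiv_diff pderiv_pCons)

lemma card_fibre:
  fixes F :: "complex poly"
  assumes "t \<notin> critical_values F"
  shows "card {x. poly F x = t} = degree F"
  using rsquarefree_card_roots[OF rsquarefree_fibre[OF assms]] by (simp add: degree_diff_const)

text \<open>
  Around a non-critical value \<open>t\<close>, disjoint discs about the \<open>m\<close> roots of \<open>F = t\<close> on which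
  \<open>F\<close> is injective already account for \<open>m\<close> preimages of every nearby value, hence for all of
  them. This is what makes analytic continuation of the roots a matter of lifting maps.
\<close>
lemma polynomial_covering_space:
  assumes "degree F \<ge> 1"
  shows "covering_space (poly F -` (- critical_values F)) (poly F) (- critical_values F)"
proof
  let ?S = "- critical_values F"
  let ?C = "poly F -` ?S"
  have openS: "open ?S"
    using finite_critical_values[OF assms] finite_imp_closed by blast
  show "continuous_on ?C (poly F)"
    by (intro continuous_intros)
  show "poly F ` ?C = ?S"
    by (rule surj_image_vimage_eq[OF surj_poly[OF assms]])
  fix t assume t: "t \<in> ?S"
  define X where "X = {x. poly F x = t}"
  have finX: "finite X"
    unfolding X_def by (rule finite_fibre[OF assms])
  have "\<exists>r>0. inj_on (poly F) (ball x r) \<and> (\<forall>y\<in>X. y \<noteq> x \<longrightarrow> 2 * r \<le> dist x y)" if "x \<in> X" for x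
  proof -
    have "deriv (poly F) x = poly (pderiv F) x"
      by (simp add: DERIV_imp_deriv poly_DERIV)
    moreover have "poly (pderiv F) x \<noteq> 0"
      using t that by (auto simp: X_def critical_values_def)
    ultimately have "deriv (poly F) x \<noteq> 0" by simp
    then obtain r where r: "r > 0" "inj_on (poly F) (ball x r)"
      using has_complex_derivative_locally_injective[of "poly F" UNIV x]
      by (metis UNIV_I holomorphic_on_poly[OF holomorphic_on_ident] open_UNIV)
    obtain d where d: "d > 0" "\<forall>y\<in>X. y \<noteq> x \<longrightarrow> d \<le> dist x y"
      using finite_set_avoid[OF finX] by blast
    show ?thesis
      by (rule exI[of _ "min r (d/2)"]) (use r d in \<open>auto intro: inj_on_subset\<close>)
  qed
  then obtain r where r0: "\<And>x. x \<in> X \<Longrightarrow> r x > 0"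
    and inj: "\<And>x. x \<in> X \<Longrightarrow> inj_on (poly F) (ball x (r x))"
    and sep: "\<And>x y. x \<in> X \<Longrightarrow> y \<in> X \<Longrightarrow> y \<noteq> x \<Longrightarrow> 2 * r x \<le> dist x y"
    by metis
  \<comment> \<open>The factor 2 in the separation makes the discs disjoint.\<close>
  have disj: "ball x (r x) \<inter> ball y (r y) = {}" if "x \<in> X" "y \<in> X" "y \<noteq> x" for x y
    using sep[OF that] sep[of y x] that
    by (intro disjoint_ballI) (auto simp: dist_commute)
  define T where "T = ?S \<inter> (\<Inter>x\<in>X. poly F ` ball x (r x))"
  have openim: "open (poly F ` ball x (r x))" if "x \<in> X" for x
    by (rule open_mapping_thm3) (use inj that in \<open>auto intro: holomorphic_intros\<close>)
  have openT: "open T"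
    unfolding T_def using openS openim finX by (auto intro!: open_Int open_INT)
  define v where "v = (\<lambda>x. ball x (r x) \<inter> poly F -` T) ` X"
  have openpre: "open (poly F -` T)"
    by (intro open_vimage openT continuous_intros)
  have "t \<in> T"
    unfolding T_def using t r0 by (auto simp: X_def)
  moreover have "openin (top_of_set ?S) T"
    using openT by (simp add: T_def open_subset)
  moreover have "\<Union>v = ?C \<inter> poly F -` T"
  proof (intro subset_antisym subsetI)
    fix y assume "y \<in> ?C \<inter> poly F -` T"
    then have yT: "poly F y \<in> T" by simp
    then have "\<forall>x\<in>X. \<exists>w. w \<in> ball x (r x) \<and> poly F w = poly F y"
      by (force simp: T_def)
    then obtain w where w: "\<And>x. x \<in> X \<Longrightarrow> w x \<in> ball x (r x)" "\<And>x. x \<in> X \<Longrightarrow> poly F (w x) = poly F y"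
      by metis
    \<comment> \<open>The chosen preimages \<open>w x\<close> are as many as the degree, so \<open>y\<close> is one of them.\<close>
    have "inj_on w X"
      using w(1) disj by (metis IntI empty_iff inj_onI)
    then have "card (w ` X) = card X"
      by (rule card_image)
    also have "\<dots> = card {x. poly F x = poly F y}"
      using t yT unfolding X_def T_def by (simp add: card_fibre)
    finally have "w ` X = {x. poly F x = poly F y}"
      using w by (intro card_subset_eq finite_fibre[OF assms]) auto
    then obtain x where "x \<in> X" "y = w x" by blast
    then show "y \<in> \<Union>v"
      using w(1) yT by (auto simp: v_def)
  qed (auto simp: v_def T_def)
  moreover have "\<forall>u\<in>v. openin (top_of_set ?C) u"
    using openpre by (auto simp: v_def T_def intro!: open_subset)
  moreover have "pairwise disjnt v"
    using disj by (fastforce simp: v_def pairwise_def disjnt_def)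
  moreover have "\<exists>q. homeomorphism u T (poly F) q" if u: "u \<in> v" for u
  proof -
    obtain x where x: "x \<in> X" "u = ball x (r x) \<inter> poly F -` T"
      using u by (auto simp: v_def)
    have "T \<subseteq> poly F ` ball x (r x)"
      using x(1) by (auto simp: T_def)
    then have im: "poly F ` u = T"
      unfolding x(2) by blast
    have "open u" "inj_on (poly F) u"
      using x openpre inj by (auto intro: inj_on_subset)
    then obtain q where q: "q holomorphic_on poly F ` u" "\<And>z. z \<in> u \<Longrightarrow> q (poly F z) = z"
      using holomorphic_has_inverse[of "poly F" u] holomorphic_on_poly[OF holomorphic_on_ident]
      by metis
    have "homeomorphism u T (poly F) q"
      unfolding homeomorphism_def im[symmetric] using q
      by (auto intro!: holomorphic_on_imp_continuous_on holomorphic_on_poly[OF holomorphic_on_ident] simp: image_image)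
    then show ?thesis by blast
  qed
  ultimately show "\<exists>T. t \<in> T \<and> openin (top_of_set ?S) T \<and>
      (\<exists>v. \<Union>v = ?C \<inter> poly F -` T \<and> (\<forall>u\<in>v. openin (top_of_set ?C) u) \<and>
           pairwise disjnt v \<and> (\<forall>u\<in>v. \<exists>q. homeomorphism u T (poly F) q))"
    by (intro exI[of _ T] exI[of _ v] conjI) auto
qed

section \<open>Relations between branches and monodromy at infinity\<close>

text \<open>
  A Puiseux parametrisation of \<open>F\<close> at infinity: with \<open>M = deg F\<close>, the equation
  \<open>F(z) = v\<^bsup>-M\<^esup>\<close> is solved by \<open>z = \<psi>(v)\<close>, so that its other solutions are
  \<open>\<psi>(\<omega> v)\<close> with \<open>\<omega>\<^sup>M = 1\<close>. In the coordinate \<open>w = 1 / z\<close> one has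
  \<open>F(z) = q(w) / w\<^sup>M\<close> with \<open>q(0) \<noteq> 0\<close>, so \<open>\<phi>(w) = w q(w)\<^bsup>-1/M\<^esup>\<close> satisfies
  \<open>\<phi>\<^sup>M = 1 / F\<close> and is locally invertible at 0; \<open>\<psi>\<close> is the inverse of \<open>\<phi>\<close> read in the
  coordinate \<open>z\<close>.
\<close>
lemma branch_at_infinity:
  fixes F :: "complex poly"
  assumes "degree F \<ge> 1"
  obtains \<rho> \<psi> where "\<rho> > 0" "\<psi> holomorphic_on ball 0 \<rho> - {0}" "inj_on \<psi> (ball 0 \<rho> - {0})"
    "\<And>v. v \<in> ball 0 \<rho> - {0} \<Longrightarrow> poly F (\<psi> v) = inverse (v ^ degree F)"
proof -
  define M where "M = degree F"
  have M: "M > 0" using assms by (simp add: M_def)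
  define q where "q = reflect_poly F"
  have "poly q 0 \<noteq> 0"
    using assms by (auto simp: q_def)
  moreover have "open {w. poly q w \<noteq> 0}"
    by (intro open_Collect_neq continuous_intros)
  ultimately obtain r where r: "r > 0" "ball 0 r \<subseteq> {w. poly q w \<noteq> 0}"
    by (metis (mono_tags, lifting) mem_Collect_eq open_contains_ball)
  obtain L where L: "L holomorphic_on ball 0 r" "\<And>w. w \<in> ball 0 r \<Longrightarrow> poly q w = exp (L w)"
    using contractible_imp_holomorphic_log[of "poly q" "ball 0 r"] r
      holomorphic_on_poly[OF holomorphic_on_ident] convex_imp_contractible[OF convex_ball]
    by (smt (verit) mem_Collect_eq subset_iff)
  define s where "s = (\<lambda>w. exp (- L w / of_nat M))"
  define \<phi> where "\<phi> = (\<lambda>w. w * s w)"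
  have hols: "s holomorphic_on ball 0 r"
    unfolding s_def using M by (intro holomorphic_intros L) auto
  have hol\<phi>: "\<phi> holomorphic_on ball 0 r"
    unfolding \<phi>_def by (intro holomorphic_intros hols)
  have pow: "\<phi> w ^ M * poly q w = w ^ M" if "w \<in> ball 0 r" for w
  proof -
    have "s w ^ M = exp (- L w)"
      unfolding s_def using M by (simp flip: exp_of_nat_mult)
    then show ?thesis
      by (simp add: \<phi>_def power_mult_distrib L(2)[OF that] flip: exp_add)
  qed
  have "(\<phi> has_field_derivative 1 * s 0 + deriv s 0 * 0) (at 0)"
    unfolding \<phi>_def using r
    by (intro DERIV_mult DERIV_ident holomorphic_derivI[OF hols]) auto
  then have "deriv \<phi> 0 = s 0"
    by (simp add: DERIV_imp_deriv)
  then have d0: "deriv \<phi> 0 \<noteq> 0"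
    by (simp add: s_def)
  have "(0::complex) \<in> ball 0 r" using r(1) by simp
  then obtain r' where r': "r' > 0" "ball (0::complex) r' \<subseteq> ball 0 r" "open (\<phi> ` ball 0 r')" "inj_on \<phi> (ball 0 r')"
    by (rule has_complex_derivative_locally_invertible[OF hol\<phi> _ open_ball d0]) (rule that, assumption+)
  have "\<phi> holomorphic_on ball 0 r'"
    using hol\<phi> r'(2) by (rule holomorphic_on_subset)
  then obtain \<kappa> where \<kappa>: "\<kappa> holomorphic_on \<phi> ` ball 0 r'" "\<And>w. w \<in> ball 0 r' \<Longrightarrow> \<kappa> (\<phi> w) = w"
    using holomorphic_has_inverse[of \<phi> "ball 0 r'"] r'(4) by (metis open_ball)
  have "0 \<in> \<phi> ` ball 0 r'"
    by (rule image_eqI[of _ _ 0]) (use r' in \<open>auto simp: \<phi>_def\<close>)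
  then obtain \<rho> where \<rho>: "\<rho> > 0" "ball (0::complex) \<rho> \<subseteq> \<phi> ` ball 0 r'"
    using r'(3) open_contains_ball by blast
  have pre: "\<exists>w. w \<in> ball 0 r' \<and> w \<noteq> 0 \<and> v = \<phi> w \<and> \<kappa> v = w" if v: "v \<in> ball 0 \<rho> - {0}" for v
  proof -
    from v \<rho> obtain w where "w \<in> ball 0 r'" "v = \<phi> w" by blast
    with v \<kappa>(2) show ?thesis
      by (intro exI[of _ w]) (auto simp: \<phi>_def)
  qed
  show ?thesis
  proof
    show "\<rho> > 0" by fact
    show "(\<lambda>v. inverse (\<kappa> v)) holomorphic_on ball 0 \<rho> - {0}"
    proof (intro holomorphic_intros)
      show "\<kappa> holomorphic_on ball 0 \<rho> - {0}"
        by (rule holomorphic_on_subset[OF \<kappa>(1)]) (use \<rho> in auto)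
    qed (use pre in blast)
    show "inj_on (\<lambda>v. inverse (\<kappa> v)) (ball 0 \<rho> - {0})"
      using pre by (smt (verit, ccfv_threshold) inj_onI inverse_eq_iff_eq)
    fix v :: complex assume v: "v \<in> ball 0 \<rho> - {0}"
    then obtain w where w: "w \<in> ball 0 r'" "w \<noteq> 0" "v = \<phi> w" "\<kappa> v = w"
      using pre by blast
    have "poly q w = w ^ M * poly F (inverse w)"
      unfolding q_def M_def using w(2) by (rule poly_reflect_poly_nz)
    with pow[of w] w r'(2) have "v ^ M * poly F (inverse w) * w ^ M = w ^ M"
      by (auto simp: mult_ac)
    then have "v ^ M * poly F (inverse w) = 1"
      using w(2) by simp
    then show "poly F (inverse (\<kappa> v)) = inverse (v ^ degree F)"
      unfolding w(4) by (metis M_def inverse_unique)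
  qed
qed

text \<open>
  A horizontal strip is simply connected and reaches infinity, and it avoids the critical values if its
  height is chosen away from their finitely many imaginary parts. Branches given on an open set that
  meets the strip therefore continue along it, and a relation between them continues with them.
\<close>
lemma continue_branches_to_strip:
  fixes F G :: "complex poly" and z :: "'i \<Rightarrow> complex \<Rightarrow> complex"
  assumes F: "degree F \<ge> 1" and U: "open U" "U \<noteq> {}"
    and z: "\<And>i. i \<in> I \<Longrightarrow> z i holomorphic_on U" "\<And>i t. i \<in> I \<Longrightarrow> t \<in> U \<Longrightarrow> poly F (z i t) = t"
    and rel: "\<And>t. t \<in> U \<Longrightarrow> (\<Sum>i\<in>I. n i * poly G (z i t)) = c"
  obtains y d w where "d > 0" "{t. \<bar>Im t - y\<bar> < d} \<inter> critical_values F = {}"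
    "\<And>i t. i \<in> I \<Longrightarrow> \<bar>Im t - y\<bar> < d \<Longrightarrow> poly F (w i t) = t"
    "\<And>t. \<bar>Im t - y\<bar> < d \<Longrightarrow> (\<Sum>i\<in>I. n i * poly G (w i t)) = c"
proof -
  let ?S = "- critical_values F"
  let ?C = "poly F -` ?S"
  have openS: "open ?S"
    using finite_critical_values[OF F] finite_imp_closed by blast
  obtain u e where e: "e > 0" "ball u e \<subseteq> U"
    using U by (meson ex_in_conv openE)
  have fin: "finite (Im ` critical_values F)"
    using finite_critical_values[OF F] by simp
  have "infinite {Im u <..< Im u + e}"
    using e by simp
  then obtain y where y: "y \<in> {Im u <..< Im u + e}" "y \<notin> Im ` critical_values F"
    using fin by (meson finite_subset subsetI)
  define t1 where "t1 = Complex (Re u) y"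
  have "dist u t1 < e"
    using y by (simp add: t1_def dist_norm complex_norm cmod_def)
  then have t1: "t1 \<in> U" "Im t1 = y"
    using e by (auto simp: t1_def)
  obtain d where d: "d > 0" "\<forall>x\<in>Im ` critical_values F. x \<noteq> y \<longrightarrow> d \<le> dist y x"
    using finite_set_avoid[OF fin] by blast
  define \<Omega> where "\<Omega> = {t. \<bar>Im t - y\<bar> < d}"
  have \<Omega>crit: "\<Omega> \<inter> critical_values F = {}"
    using d y by (fastforce simp: \<Omega>_def dist_real_def)
  have \<Omega>eq: "\<Omega> = Im -` ball y d"
    by (auto simp: \<Omega>_def dist_real_def)
  have op\<Omega>: "open \<Omega>"
    unfolding \<Omega>eq by (intro open_vimage continuous_intros) auto
  have "convex \<Omega>"
    unfolding \<Omega>eq by (intro convex_linear_vimage convex_ball bounded_linear.linear bounded_linear_Im)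
  then have sc: "simply_connected \<Omega>" and lpc: "locally path_connected \<Omega>" and con: "connected \<Omega>"
    by (auto intro: convex_imp_simply_connected convex_imp_locally_path_connected convex_connected)
  have t1\<Omega>: "t1 \<in> \<Omega>"
    using t1 d by (simp add: \<Omega>_def)
  have cov: "covering_space ?C (poly F) ?S"
    by (rule polynomial_covering_space[OF F])
  have "\<exists>w. continuous_on \<Omega> w \<and> w \<in> \<Omega> \<rightarrow> ?C \<and> w t1 = z i t1 \<and> (\<forall>t\<in>\<Omega>. poly F (w t) = t)"
    if i: "i \<in> I" for i
  proof -
    have "z i t1 \<in> ?C"
      using z(2)[OF i t1(1)] t1\<Omega> \<Omega>crit by auto
    then show ?thesis
      using covering_space_lift_strong[OF cov _ t1\<Omega> sc lpc, of "z i t1" "\<lambda>t. t"] z(2)[OF i t1(1)] \<Omega>crit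
      by (smt (verit, ccfv_SIG) ComplI Pi_I continuous_on_id disjoint_iff)
  qed
  then obtain w where w: "\<And>i. i \<in> I \<Longrightarrow> continuous_on \<Omega> (w i)" "\<And>i. i \<in> I \<Longrightarrow> w i \<in> \<Omega> \<rightarrow> ?C"
     "\<And>i. i \<in> I \<Longrightarrow> w i t1 = z i t1" "\<And>i t. i \<in> I \<Longrightarrow> t \<in> \<Omega> \<Longrightarrow> poly F (w i t) = t"
    by metis
  have holw: "w i holomorphic_on \<Omega>" if "i \<in> I" for i
  proof (rule covering_space_lift_is_holomorphic[OF cov])
    show "open ?C"
      by (intro open_vimage openS continuous_intros)
    show "(\<lambda>t. t) \<in> \<Omega> \<rightarrow> ?S"
      using \<Omega>crit by auto
  qed (use w that in \<open>auto intro!: holomorphic_intros\<close>)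
  obtain e' where e': "e' > 0" "ball t1 e' \<subseteq> U \<inter> \<Omega>"
    using openE[OF open_Int[OF U(1) op\<Omega>]] t1 t1\<Omega> by (metis IntI)
  have eq: "w i t = z i t" if i: "i \<in> I" and t: "t \<in> ball t1 e'" for i t
  proof (rule covering_space_lift_unique[OF cov, where f = "\<lambda>t. t" and T = "ball t1 e'" and a = t1
        and ?g1.0 = "w i" and ?g2.0 = "z i" and x = t])
    show "w i t1 = z i t1" by (rule w(3)[OF i])
    show "continuous_on (ball t1 e') (w i)"
      using w(1)[OF i] e' by (auto intro: continuous_on_subset)
    show "continuous_on (ball t1 e') (z i)"
      using z(1)[OF i] e' by (auto intro!: holomorphic_on_imp_continuous_on intro: holomorphic_on_subset)
    show "z i \<in> ball t1 e' \<rightarrow> ?C"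
      using z(2)[OF i] e'(2) \<Omega>crit by force
    show "w i \<in> ball t1 e' \<rightarrow> ?C" using w(2)[OF i] e'(2) by auto
    show "(\<lambda>t. t) \<in> ball t1 e' \<rightarrow> ?S" using \<Omega>crit e'(2) by auto
    show "x = poly F (w i x)" if "x \<in> ball t1 e'" for x using that w(4)[OF i] e'(2) by auto
    show "x = poly F (z i x)" if "x \<in> ball t1 e'" for x using that z(2)[OF i] e'(2) by auto
  qed (use t e' in auto)
  have "(\<Sum>i\<in>I. n i * poly G (w i t)) = c" if "t \<in> \<Omega>" for t
  proof (rule analytic_continuation_open[of "ball t1 e'" \<Omega> "\<lambda>t. \<Sum>i\<in>I. n i * poly G (w i t)" "\<lambda>_. c"])
    show "(\<lambda>t. \<Sum>i\<in>I. n i * poly G (w i t)) holomorphic_on \<Omega>"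
      by (intro holomorphic_intros holw)
    show "(\<Sum>i\<in>I. n i * poly G (w i x)) = c" if "x \<in> ball t1 e'" for x
    proof -
      have "(\<Sum>i\<in>I. n i * poly G (w i x)) = (\<Sum>i\<in>I. n i * poly G (z i x))"
        using eq that by (intro sum.cong) auto
      then show ?thesis using rel e'(2) that by auto
    qed
  qed (use op\<Omega> con e' that in auto)
  then show ?thesis
    using that[of d y w] d \<Omega>crit w(4) unfolding \<Omega>_def by blast
qed

text \<open>
  The role of transitive monodromy. Continued to infinity and expressed by \<open>\<psi>\<close>, the relation reads
  \<open>\<Sum>\<^sub>i n\<^sub>i G(\<psi>(\<sigma>\<^sub>i v)) = c\<close> with roots of unity \<open>\<sigma>\<^sub>i\<close>, and it holds on the whole
  punctured disc. Summing it over all rotations of \<open>v\<close> makes the terms independent of \<open>i\<close>. The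
  index set may list only some of the roots of \<open>F\<close>, as it does for \<open>F = f + \<epsilon> g\<close> when
  \<open>deg g > deg f\<close>.
\<close>
lemma constant_weighted_sum_of_branches_eq_0:
  fixes F G :: "complex poly" and z :: "'i \<Rightarrow> complex \<Rightarrow> complex"
  assumes U: "open U" "U \<noteq> {}" and I: "finite I"
    and z: "\<And>i. i \<in> I \<Longrightarrow> z i holomorphic_on U" "\<And>i t. i \<in> I \<Longrightarrow> t \<in> U \<Longrightarrow> poly F (z i t) = t"
    and n: "(\<Sum>i\<in>I. n i) = 0"
    and rel: "\<And>t. t \<in> U \<Longrightarrow> (\<Sum>i\<in>I. n i * poly G (z i t)) = c"
  shows "c = 0"
proof (cases "I = {}")
  case True
  then show ?thesis using rel U by auto
next
  case False
  then obtain i0 where i0: "i0 \<in> I" by blast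
  have F: "degree F \<ge> 1"
  proof (rule ccontr)
    assume "\<not> degree F \<ge> 1"
    then obtain b where "F = [:b:]"
      by (metis degree_eq_zeroE less_one not_le)
    then have "U \<subseteq> {b}"
      using z(2)[OF i0] by auto
    then show False
      using U by (metis finite.emptyI finite.insertI finite_imp_not_open finite_subset)
  qed
  define M where "M = degree F"
  have M: "M > 0" using F by (simp add: M_def)
  obtain y d w where d: "d > 0" and crit: "{t. \<bar>Im t - y\<bar> < d} \<inter> critical_values F = {}"
    and w: "\<And>i t. i \<in> I \<Longrightarrow> \<bar>Im t - y\<bar> < d \<Longrightarrow> poly F (w i t) = t"
    and relw: "\<And>t. \<bar>Im t - y\<bar> < d \<Longrightarrow> (\<Sum>i\<in>I. n i * poly G (w i t)) = c"
    by (rule continue_branches_to_strip[where F = F and U = U and I = I and z = z and n = n and G = G and c = c])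
      (use F U z rel in auto)
  define \<Omega> where "\<Omega> = {t. \<bar>Im t - y\<bar> < d}"
  have op\<Omega>: "open \<Omega>"
    unfolding \<Omega>_def by (intro open_Collect_less continuous_intros)
  obtain \<rho> \<psi> where \<rho>: "\<rho> > 0" and hol\<psi>: "\<psi> holomorphic_on ball 0 \<rho> - {0}"
    and inj\<psi>: "inj_on \<psi> (ball 0 \<rho> - {0})"
    and \<psi>: "\<And>v. v \<in> ball 0 \<rho> - {0} \<Longrightarrow> poly F (\<psi> v) = inverse (v ^ M)"
    using branch_at_infinity[OF F] unfolding M_def by blast
  define D where "D = ball (0::complex) \<rho> - {0}"
  have D: "open D" "connected D"
    unfolding D_def by (auto intro: connected_punctured_ball)
  define R where "R = {\<omega>::complex. \<omega> ^ M = 1}"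
  have finR: "finite R" and cardR: "card R = M"
    using M unfolding R_def by (auto simp: card_roots_unity_eq)
  have normR: "cmod \<omega> = 1" if "\<omega> \<in> R" for \<omega>
  proof -
    have "cmod \<omega> ^ M = 1 ^ M"
      using that by (simp add: R_def flip: norm_power)
    then show ?thesis
      by (rule power_eq_imp_eq_base) (use M in auto)
  qed
  have rotD: "\<omega> * v \<in> D" if "\<omega> \<in> R" "v \<in> D" for \<omega> v
    using normR[OF that(1)] that by (auto simp: D_def norm_mult R_def M)
  have fibre: "\<exists>\<omega>\<in>R. x = \<psi> (\<omega> * v)"
    if v: "v \<in> D" "inverse (v ^ M) \<in> \<Omega>" "poly F x = inverse (v ^ M)" for v x
  proof -
    have "inj_on (\<lambda>\<omega>. \<psi> (\<omega> * v)) R"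
    proof (rule inj_onI)
      fix \<omega> \<omega>' assume "\<omega> \<in> R" "\<omega>' \<in> R" "\<psi> (\<omega> * v) = \<psi> (\<omega>' * v)"
      then have "\<omega> * v = \<omega>' * v"
        using inj\<psi> rotD v(1) by (metis D_def inj_onD)
      then show "\<omega> = \<omega>'" using v(1) by (simp add: D_def)
    qed
    then have "card ((\<lambda>\<omega>. \<psi> (\<omega> * v)) ` R) = M"
      using cardR by (simp add: card_image)
    also have "\<dots> = card {x. poly F x = inverse (v ^ M)}"
    proof -
      have "inverse (v ^ M) \<notin> critical_values F"
        using crit v(2) unfolding \<Omega>_def by blast
      then show ?thesis by (simp add: card_fibre M_def)
    qed
    finally have "(\<lambda>\<omega>. \<psi> (\<omega> * v)) ` R = {x. poly F x = inverse (v ^ M)}"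
    proof (intro card_subset_eq finite_fibre[OF F] subsetI)
      fix x' assume "x' \<in> (\<lambda>\<omega>. \<psi> (\<omega> * v)) ` R"
      then obtain \<omega> where "\<omega> \<in> R" "x' = \<psi> (\<omega> * v)" by blast
      then show "x' \<in> {x. poly F x = inverse (v ^ M)}"
        using \<psi> rotD[OF _ v(1)] by (auto simp: D_def power_mult_distrib R_def)
    qed
    then show ?thesis using v(3) by blast
  qed
  have "\<exists>v0. v0 \<in> D \<and> inverse (v0 ^ M) \<in> \<Omega>"
  proof -
    \<comment> \<open>A point of the strip so far out that its \<open>M\<close>-th roots lie beyond radius \<open>1 / \<rho>\<close>.\<close>
    define T where "T = Complex (2 / \<rho> ^ M) y"
    have T: "cmod T \<ge> 2 / \<rho> ^ M" "T \<noteq> 0"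
      using complex_Re_le_cmod[of T] \<rho> by (auto simp: T_def complex_eq_iff)
    define v0 where "v0 = exp (- Ln T / of_nat M)"
    have "v0 ^ M = exp (of_nat M * (- Ln T / of_nat M))"
      unfolding v0_def by (rule exp_of_nat_mult[symmetric])
    then have v0: "v0 ^ M = inverse T"
      using M T by (simp add: exp_minus)
    have "cmod v0 ^ M = inverse (cmod T)"
      using v0 by (metis norm_inverse norm_power)
    also have "\<dots> \<le> inverse (2 / \<rho> ^ M)"
      using T \<rho> by (intro le_imp_inverse_le) auto
    also have "\<dots> < \<rho> ^ M"
      using \<rho> by simp
    finally have "cmod v0 < \<rho>"
      by (rule power_less_imp_less_base) (use \<rho> in simp)
    then show ?thesis
      using v0 d by (intro exI[of _ v0]) (auto simp: D_def v0_def \<Omega>_def T_def)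
  qed
  then obtain v0 where v0: "v0 \<in> D" "inverse (v0 ^ M) \<in> \<Omega>" by blast
  have "open (D \<inter> (\<lambda>v. inverse (v ^ M)) -` \<Omega>)"
    by (rule continuous_open_preimage) (use D op\<Omega> in \<open>auto intro!: continuous_intros simp: D_def\<close>)
  then obtain e where e: "e > 0" "cball v0 e \<subseteq> D \<inter> (\<lambda>v. inverse (v ^ M)) -` \<Omega>"
    using v0 open_contains_cball by (metis IntI vimageI)
  \<comment> \<open>Which root of unity belongs to which branch may a priori depend on \<open>v\<close>. As there are finitely
    many assignments, one of them occurs on a set with a limit point, which suffices to continue
    the relation.\<close>
  have "infinite (ball v0 e)"
    using e(1) by (metis centre_in_ball empty_iff finite_imp_not_open open_ball)
  then have "infinite (cball v0 e)"
    by (meson ball_subset_cball finite_subset)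
  moreover have "finite (PiE I (\<lambda>_. R))"
    using I finR by (simp add: finite_PiE)
  moreover have "\<forall>v\<in>cball v0 e. \<exists>\<sigma>\<in>PiE I (\<lambda>_. R). \<forall>i\<in>I. w i (inverse (v ^ M)) = \<psi> (\<sigma> i * v)"
  proof
    fix v assume "v \<in> cball v0 e"
    then have v: "v \<in> D" "inverse (v ^ M) \<in> \<Omega>" using e by auto
    have "\<forall>i\<in>I. \<exists>\<omega>\<in>R. w i (inverse (v ^ M)) = \<psi> (\<omega> * v)"
      using fibre[OF v] w v(2) by (simp add: \<Omega>_def)
    then obtain \<sigma> where "\<forall>i\<in>I. \<sigma> i \<in> R \<and> w i (inverse (v ^ M)) = \<psi> (\<sigma> i * v)" by metis
    then show "\<exists>\<sigma>\<in>PiE I (\<lambda>_. R). \<forall>i\<in>I. w i (inverse (v ^ M)) = \<psi> (\<sigma> i * v)"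
      by (intro bexI[of _ "restrict \<sigma> I"]) auto
  qed
  ultimately obtain \<sigma> where \<sigma>: "\<sigma> \<in> PiE I (\<lambda>_. R)"
    and inf: "infinite {v \<in> cball v0 e. \<forall>i\<in>I. w i (inverse (v ^ M)) = \<psi> (\<sigma> i * v)}" (is "infinite ?A")
    using pigeonhole_infinite_rel[of "cball v0 e" "PiE I (\<lambda>_. R)"
       "\<lambda>v \<sigma>. \<forall>i\<in>I. w i (inverse (v ^ M)) = \<psi> (\<sigma> i * v)"] by blast
  obtain \<xi> where \<xi>: "\<xi> \<in> cball v0 e" "\<xi> islimpt ?A"
    using inf compact_cball[of v0 e] unfolding compact_eq_Bolzano_Weierstrass
    by (metis (no_types, lifting) mem_Collect_eq subsetI)
  have all: "(\<Sum>i\<in>I. n i * poly G (\<psi> (\<sigma> i * v))) - c = 0" if "v \<in> D" for v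
  proof (rule analytic_continuation[of "\<lambda>v. (\<Sum>i\<in>I. n i * poly G (\<psi> (\<sigma> i * v))) - c" D ?A \<xi>])
    have "(\<lambda>v. \<psi> (\<sigma> i * v)) holomorphic_on D" if "i \<in> I" for i
    proof (rule holomorphic_on_compose_gen[OF _ hol\<psi>, of "\<lambda>v. \<sigma> i * v" D, unfolded o_def])
      show "(\<lambda>v. \<sigma> i * v) ` D \<subseteq> ball 0 \<rho> - {0}"
        using rotD \<sigma> that unfolding D_def[symmetric] by (auto simp: PiE_mem)
    qed (intro holomorphic_intros)
    then show "(\<lambda>v. (\<Sum>i\<in>I. n i * poly G (\<psi> (\<sigma> i * v))) - c) holomorphic_on D"
      by (intro holomorphic_intros)
    show "?A \<subseteq> D" using e by auto
    show "\<xi> \<in> D" using \<xi>(1) e by auto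
    fix v assume v: "v \<in> ?A"
    then have "inverse (v ^ M) \<in> \<Omega>" using e by auto
    then have "(\<Sum>i\<in>I. n i * poly G (w i (inverse (v ^ M)))) = c"
      using relw by (simp add: \<Omega>_def)
    then show "(\<Sum>i\<in>I. n i * poly G (\<psi> (\<sigma> i * v))) - c = 0"
      using v by simp
  qed (use D \<xi> that in auto)
  define S where "S = (\<Sum>\<tau>\<in>R. poly G (\<psi> (\<tau> * v0)))"
  have rot: "(\<Sum>\<tau>\<in>R. poly G (\<psi> (\<sigma> i * (\<tau> * v0)))) = S" if "i \<in> I" for i
  proof -
    have \<sigma>i: "\<sigma> i \<in> R" using \<sigma> that by auto
    then have "\<sigma> i \<noteq> 0" using M by (auto simp: R_def power_0_left)
    have "bij_betw (\<lambda>\<tau>. \<sigma> i * \<tau>) R R"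
    proof (rule bij_betw_byWitness[where f' = "\<lambda>\<tau>. inverse (\<sigma> i) * \<tau>"])
    qed (use \<sigma>i \<open>\<sigma> i \<noteq> 0\<close> in \<open>auto simp: R_def power_mult_distrib field_simps power_inverse\<close>)
    from sum.reindex_bij_betw[OF this, of "\<lambda>\<tau>. poly G (\<psi> (\<tau> * v0))"] show ?thesis
      by (simp add: S_def mult.assoc)
  qed
  have "of_nat M * c = (\<Sum>\<tau>\<in>R. c)"
    by (simp add: cardR)
  also have "\<dots> = (\<Sum>\<tau>\<in>R. \<Sum>i\<in>I. n i * poly G (\<psi> (\<sigma> i * (\<tau> * v0))))"
    using all rotD v0(1) by (intro sum.cong) auto
  also have "\<dots> = (\<Sum>i\<in>I. n i * (\<Sum>\<tau>\<in>R. poly G (\<psi> (\<sigma> i * (\<tau> * v0)))))"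
    by (subst sum.swap) (simp add: sum_distrib_left)
  also have "\<dots> = (\<Sum>i\<in>I. n i * S)"
    using rot by simp
  also have "\<dots> = 0"
    using n by (simp flip: sum_distrib_right)
  finally show "c = 0"
    using M by simp
qed

section \<open>Common right factors and joint fibres\<close>

text \<open>
  An element of \<open>\<complex>[z][X]\<close> is a polynomial in \<open>X\<close> whose coefficients are polynomials in \<open>z\<close>;
  specialising \<open>z\<close> leaves a polynomial in \<open>X\<close>.
\<close>
definition fibre_poly :: "complex \<Rightarrow> complex poly poly \<Rightarrow> complex poly" where
  "fibre_poly z D = map_poly (\<lambda>c. poly c z) D"

lemma poly_fibre_poly: "poly (fibre_poly z D) x = poly (poly D [:x:]) z"
  by (induction D) (simp_all add: fibre_poly_def map_poly_pCons)

text \<open>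
  The polynomial \<open>f(X) - f(z)\<close> in \<open>\<complex>[z][X]\<close>.
\<close>
definition fibre_equation :: "complex poly \<Rightarrow> complex poly poly" where
  "fibre_equation f = map_poly (\<lambda>c. [:c:]) f - [:f:]"

lemma poly_fibre_equation: "poly (poly (fibre_equation f) [:x:]) z = poly f x - poly f z"
proof -
  have "poly (map_poly (\<lambda>c. [:c:]) f) [:x:] = [:poly f x:]"
    by (induction f) (simp_all add: map_poly_pCons)
  then show ?thesis by (simp add: fibre_equation_def)
qed

lemma finite_poly_vimage:
  fixes f :: "complex poly"
  assumes "degree f \<ge> 1" "finite Y"
  shows "finite {z. poly f z \<in> Y}"
proof -
  have "{z. poly f z \<in> Y} = (\<Union>y\<in>Y. {z. poly f z = y})" by blast
  then show ?thesis using assms finite_fibre by simp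
qed

text \<open>
  An element \<open>D\<close> of least degree in \<open>X\<close> of the ideal of \<open>\<complex>[z][X]\<close> generated by
  \<open>f(X) - f(z)\<close> and \<open>g(X) - g(z)\<close> divides both generators up to factors from \<open>\<complex>[z]\<close>.
  So for all but finitely many \<open>z\<close> the roots of \<open>D\<close> are exactly the points of the joint fibre of
  \<open>f\<close> and \<open>g\<close> through \<open>z\<close>, and they are simple because those of \<open>f(X) - f(z)\<close> are. In
  particular the joint fibre has a generic cardinality, and the product of its points, being
  \<open>\<plusminus>D(z, 0)\<close> divided by the leading coefficient of \<open>D\<close>, is a rational function of \<open>z\<close>.
\<close>
lemma common_fibre_equation:
  fixes f g :: "complex poly"
  assumes f: "degree f \<ge> 1"
  obtains d p q B where "finite B" "q \<noteq> 0"
    "\<And>z. z \<notin> B \<Longrightarrow> card {x. poly f x = poly f z \<and> poly g x = poly g z} = d"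
    "\<And>z. z \<notin> B \<Longrightarrow> poly p z = poly q z * (\<Prod>x | poly f x = poly f z \<and> poly g x = poly g z. - x)"
proof -
  let ?A = "fibre_equation f" and ?B = "fibre_equation g"
  define J where "J = {D. \<exists>S T. D = S * ?A + T * ?B}"
  have "?A \<noteq> 0"
  proof
    assume "?A = 0"
    then have "poly f x = poly f 0" for x
      using poly_fibre_equation[of f x 0] by simp
    then have "{x. poly f x = poly f 0} = UNIV" by blast
    then show False
      using finite_fibre[OF f, of "poly f 0"] infinite_UNIV_char_0 by metis
  qed
  moreover have "?A = 1 * ?A + 0 * ?B" "?B = 0 * ?A + 1 * ?B" by simp_all
  then have AB: "?A \<in> J" "?B \<in> J"
    unfolding J_def by blast+
  ultimately obtain D where D: "D \<in> J" "D \<noteq> 0"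
    and min: "\<And>E. E \<in> J \<Longrightarrow> E \<noteq> 0 \<Longrightarrow> degree D \<le> degree E"
    using ex_has_least_nat[of "\<lambda>D. D \<in> J \<and> D \<noteq> 0" ?A degree] by blast
  obtain S T where ST: "D = S * ?A + T * ?B"
    using D(1) by (auto simp: J_def)
  have dvd: "\<exists>a q. a \<noteq> 0 \<and> smult a E = D * q" if E: "E \<in> J" for E
  proof -
    obtain a q where aq: "a \<noteq> 0" "smult a E = D * q + pseudo_mod E D"
      using pseudo_mod(1)[OF D(2)] by blast
    obtain S' T' where "E = S' * ?A + T' * ?B"
      using E by (auto simp: J_def)
    moreover have "pseudo_mod E D = smult a E - D * q"
      using aq(2) by simp
    ultimately have "pseudo_mod E D = (smult a S' - q * S) * ?A + (smult a T' - q * T) * ?B"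
      using ST by (simp add: algebra_simps smult_add_right)
    then have "pseudo_mod E D \<in> J"
      unfolding J_def by blast
    then have "pseudo_mod E D = 0"
      using pseudo_mod(2)[OF D(2), of E] min by fastforce
    then show ?thesis using aq by auto
  qed
  obtain a q where a: "a \<noteq> 0" "smult a ?A = D * q"
    using dvd[OF AB(1)] by blast
  obtain b r where b: "b \<noteq> 0" "smult b ?B = D * r"
    using dvd[OF AB(2)] by blast
  define B where "B = {z. poly f z \<in> critical_values f} \<union> {z. poly (a * b * lead_coeff D) z = 0}"
  have "finite {z. poly f z \<in> critical_values f}"
    using f by (intro finite_poly_vimage finite_critical_values)
  moreover have "finite {z. poly (a * b * lead_coeff D) z = 0}"
    using a(1) b(1) D(2) by (intro poly_roots_finite) auto
  ultimately have finB: "finite B"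
    by (simp add: B_def)
  have main: "card {x. poly f x = poly f z \<and> poly g x = poly g z} = degree D \<and>
      poly (poly D 0) z = poly (lead_coeff D) z * (\<Prod>x | poly f x = poly f z \<and> poly g x = poly g z. - x)"
    if z: "z \<notin> B" for z
  proof -
    let ?D = "fibre_poly z D"
    have nz: "poly f z \<notin> critical_values f" "poly a z \<noteq> 0" "poly b z \<noteq> 0" "poly (lead_coeff D) z \<noteq> 0"
      using z by (auto simp: B_def)
    have deg: "degree ?D = degree D"
      unfolding fibre_poly_def using nz(4) by (rule map_poly_degree_eq)
    then have lc: "lead_coeff ?D = poly (lead_coeff D) z"
      by (simp add: fibre_poly_def coeff_map_poly)
    have evA: "poly ?D x * poly (fibre_poly z q) x = poly a z * (poly f x - poly f z)" for x
      using arg_cong[OF a(2), of "\<lambda>P. poly (poly P [:x:]) z"]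
      by (simp add: poly_fibre_poly poly_fibre_equation)
    have evB: "poly ?D x * poly (fibre_poly z r) x = poly b z * (poly g x - poly g z)" for x
      using arg_cong[OF b(2), of "\<lambda>P. poly (poly P [:x:]) z"]
      by (simp add: poly_fibre_poly poly_fibre_equation)
    have roots: "{x. poly ?D x = 0} = {x. poly f x = poly f z \<and> poly g x = poly g z}"
    proof (intro Collect_cong iffI)
      fix x assume "poly ?D x = 0"
      then show "poly f x = poly f z \<and> poly g x = poly g z"
        using evA[of x] evB[of x] nz by auto
    next
      fix x assume "poly f x = poly f z \<and> poly g x = poly g z"
      then show "poly ?D x = 0"
        using arg_cong[OF ST, of "\<lambda>P. poly (poly P [:x:]) z"]
        by (simp add: poly_fibre_poly poly_fibre_equation)
    qed
    have "poly (?D * fibre_poly z q) = poly (smult (poly a z) (f - [:poly f z:]))"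
      using evA by auto
    then have "?D * fibre_poly z q = smult (poly a z) (f - [:poly f z:])"
      by (simp only: poly_eq_poly_eq_iff)
    from arg_cong[OF this, of pderiv]
    have der: "?D * pderiv (fibre_poly z q) + fibre_poly z q * pderiv ?D = smult (poly a z) (pderiv f)"
      by (simp add: pderiv_mult pderiv_smult pderiv_diff pderiv_pCons)
    have sqf: "rsquarefree ?D"
      unfolding rsquarefree_roots
    proof (intro allI notI, elim conjE)
      fix x assume x: "poly ?D x = 0" "poly (pderiv ?D) x = 0"
      then have "poly (pderiv f) x = 0"
        using arg_cong[OF der, of "\<lambda>P. poly P x"] nz by simp
      moreover have "poly f x = poly f z"
        using x roots by blast
      ultimately show False
        using nz(1) unfolding critical_values_def by (metis (mono_tags, lifting) image_eqI mem_Collect_eq)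
    qed
    have "poly ?D 0 = poly (smult (lead_coeff ?D) (\<Prod>x|poly ?D x = 0. [:-x, 1:])) 0"
      using complex_poly_decompose_rsquarefree[OF sqf] by simp
    then have "poly (poly D 0) z = poly (lead_coeff D) z * (\<Prod>x|poly ?D x = 0. - x)"
      by (simp add: poly_prod lc poly_fibre_poly)
    then show ?thesis
      using rsquarefree_card_roots[OF sqf] unfolding roots deg by simp
  qed
  show ?thesis
    by (rule that[of B "lead_coeff D" "degree D" "poly D 0"]) (use finB D(2) main in auto)
qed

text \<open>
  Both sides of \<open>f(x) = f(z)\<close> grow like the same power of their arguments.
\<close>
lemma fibre_growth:
  fixes f :: "complex poly"
  assumes f: "degree f \<ge> 1"
  obtains K where "K \<ge> 1" "\<And>x z. poly f x = poly f z \<Longrightarrow> cmod x \<le> K * (1 + cmod z)"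
proof -
  define m where "m = degree f"
  define c where "c = cmod (lead_coeff f)"
  have c: "c > 0" using f by (auto simp: c_def)
  have "((\<lambda>x. cmod (poly f x / x ^ m)) \<longlongrightarrow> c) at_infinity"
    unfolding c_def m_def by (intro tendsto_norm poly_divide_tendsto_aux)
  then have "\<forall>\<^sub>F x in at_infinity. cmod (poly f x / x ^ m) > c / 2"
    by (rule order_tendstoD) (use c in auto)
  then obtain R where R: "\<And>x. cmod x \<ge> R \<Longrightarrow> cmod (poly f x / x ^ m) > c / 2"
    by (auto simp: eventually_at_infinity)
  define C where "C = (\<Sum>i\<le>m. cmod (coeff f i))"
  have C: "cmod (poly f z) \<le> C * (1 + cmod z) ^ m" for z
  proof -
    have "cmod (poly f z) \<le> (\<Sum>i\<le>m. cmod (coeff f i * z ^ i))"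
      unfolding poly_altdef m_def by (rule norm_sum)
    also have "\<dots> \<le> (\<Sum>i\<le>m. cmod (coeff f i) * (1 + cmod z) ^ m)"
    proof (rule sum_mono)
      fix i assume "i \<in> {..m}"
      then have "cmod z ^ i \<le> (1 + cmod z) ^ m"
        using power_mono[of "cmod z" "1 + cmod z" i] power_increasing[of i m "1 + cmod z"] by simp
      then show "cmod (coeff f i * z ^ i) \<le> cmod (coeff f i) * (1 + cmod z) ^ m"
        by (simp add: norm_mult norm_power mult_left_mono)
    qed
    finally show ?thesis by (simp add: C_def sum_distrib_right)
  qed
  define K where "K = max 1 (max R (2 * C / c))"
  have K: "K \<ge> 1" "K \<ge> R" "K \<ge> 2 * C / c" by (auto simp: K_def)
  have "cmod x \<le> K * (1 + cmod z)" if eq: "poly f x = poly f z" for x z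
  proof (cases "x \<noteq> 0 \<and> cmod x \<ge> R")
    case True
    then have "c / 2 * cmod x ^ m < cmod (poly f x)"
      using R[of x] by (simp add: norm_divide norm_power field_simps)
    also have "\<dots> \<le> C * (1 + cmod z) ^ m"
      using C[of z] eq by simp
    finally have "cmod x ^ m \<le> (2 * C / c) * (1 + cmod z) ^ m"
      using c by (simp add: field_simps)
    also have "\<dots> \<le> K ^ m * (1 + cmod z) ^ m"
    proof (intro mult_right_mono)
      have "K \<le> K ^ m"
        using K(1) f unfolding m_def by (intro self_le_power) auto
      then show "2 * C / c \<le> K ^ m" using K(3) by linarith
    qed auto
    finally have "cmod x ^ m \<le> (K * (1 + cmod z)) ^ m"
      by (simp add: power_mult_distrib)
    then show ?thesis
      using K f by (subst (asm) power_mono_iff) (auto simp: m_def)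
  next
    case False
    have "1 * 1 \<le> K * (1 + cmod z)"
      by (rule mult_mono) (use K in auto)
    moreover have "K * 1 \<le> K * (1 + cmod z)"
      by (rule mult_left_mono) (use K in auto)
    moreover have "cmod x = 0 \<or> cmod x < R"
      using False by auto
    ultimately show ?thesis
      using K(2) by linarith
  qed
  then show ?thesis using that K(1) by blast
qed

lemma le_off_finite_imp_le:
  fixes u v :: "complex \<Rightarrow> real"
  assumes "continuous_on UNIV u" "continuous_on UNIV v" "finite B" "\<And>z. z \<notin> B \<Longrightarrow> u z \<le> v z"
  shows "u z \<le> v z"
proof -
  have "closed {z. u z \<le> v z}"
    using assms by (intro closed_Collect_le)
  then have "closure (- B) \<subseteq> {z. u z \<le> v z}"
    using assms(4) by (intro closure_minimal) auto
  then show ?thesis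
    using assms(3) by (simp add: closure_complement empty_interior_finite subset_iff)
qed

lemma degree_le_growth:
  fixes h :: "complex poly"
  assumes "\<And>z. cmod z \<ge> 1 \<Longrightarrow> cmod (poly h z) \<le> K * cmod z ^ d"
  shows "degree h \<le> d"
proof (rule ccontr)
  assume "\<not> degree h \<le> d"
  then have "degree (monom (1::complex) d) < degree h"
    by (simp add: degree_monom_eq)
  from poly_divide_tendsto_0_at_infinity[OF this]
  have "((\<lambda>z. z ^ d / poly h z) \<longlongrightarrow> 0) at_infinity"
    by (simp add: poly_monom)
  then have "((\<lambda>z. cmod (z ^ d / poly h z)) \<longlongrightarrow> 0) at_infinity"
    by (rule tendsto_norm_zero)
  then have "\<forall>\<^sub>F z in at_infinity. cmod (z ^ d / poly h z) < 1 / (\<bar>K\<bar> + 1)"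
    by (rule order_tendstoD) simp
  moreover have "\<forall>\<^sub>F z in at_infinity. poly h z \<noteq> 0"
    using \<open>\<not> degree h \<le> d\<close> filterlim_poly_at_infinity[of h] eventually_not_equal_at_infinity
    by (auto simp: filterlim_iff)
  moreover have "\<forall>\<^sub>F z in at_infinity. cmod z \<ge> 1"
    by (auto simp: eventually_at_infinity)
  ultimately have "\<forall>\<^sub>F z in (at_infinity :: complex filter). False"
  proof eventually_elim
    case (elim z)
    have "cmod z ^ d * (\<bar>K\<bar> + 1) < cmod (poly h z)"
      using elim(1,2) by (simp add: norm_divide norm_power field_simps)
    also have "\<dots> \<le> K * cmod z ^ d"
      using assms elim(3) by blast
    also have "\<dots> \<le> (\<bar>K\<bar> + 1) * cmod z ^ d"
      by (intro mult_right_mono) auto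
    finally show False by (simp add: mult.commute)
  qed
  then show False by (simp add: trivial_limit_at_infinity)
qed

lemma card_roots_le_degree:
  fixes p :: "complex poly"
  assumes "p \<noteq> 0" "X \<subseteq> {x. poly p x = 0}"
  shows "card X \<le> degree p"
  using card_mono[OF poly_roots_finite[OF assms(1)] assms(2)] card_poly_roots_bound[OF assms(1)] by linarith

text \<open>
  The product \<open>h(z)\<close> of the negatives of the \<open>d\<close> points \<open>x\<close> of the joint fibre through
  \<open>z\<close> is a rational function. It is locally bounded because \<open>\<bar>x\<bar> \<le> K (1 + \<bar>z\<bar>)\<close>, so it
  has no poles and is a polynomial; the same bound limits its degree to \<open>d\<close>. By construction
  \<open>h\<close> is constant on joint fibres, which have \<open>d\<close> points. So, if \<open>h\<close> is not constant, its
  degree is \<open>d\<close> and its fibres are generically the joint fibres. It is not constant: as \<open>z\<close>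
  itself is one of the factors, \<open>h(0) = 0\<close>, and \<open>h = 0\<close> would put 0 into almost every fibre of
  \<open>f\<close>.
\<close>
lemma generic_common_fibre:
  fixes f g :: "complex poly"
  assumes f: "degree f \<ge> 1"
  obtains h B where "degree h \<ge> 1" "finite B"
    "\<And>z. z \<notin> B \<Longrightarrow> {x. poly h x = poly h z} = {x. poly f x = poly f z \<and> poly g x = poly g z}"
    "\<And>z. z \<notin> B \<Longrightarrow> card {x. poly h x = poly h z} = degree h"
proof -
  define S where "S z = {x. poly f x = poly f z \<and> poly g x = poly g z}" for z
  obtain d p q B where B: "finite B" and q: "q \<noteq> 0"
    and card: "\<And>z. z \<notin> B \<Longrightarrow> card (S z) = d"
    and pq: "\<And>z. z \<notin> B \<Longrightarrow> poly p z = poly q z * (\<Prod>x\<in>S z. - x)"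
    by (rule common_fibre_equation[OF f, where g = g, folded S_def]) (rule that, assumption+)
  obtain K where K: "K \<ge> 1" "\<And>x z. poly f x = poly f z \<Longrightarrow> cmod x \<le> K * (1 + cmod z)"
    by (rule fibre_growth[OF f]) (rule that, assumption+)
  have finS: "finite (S z)" for z
    by (rule finite_subset[OF _ finite_fibre[OF f, of "poly f z"]]) (auto simp: S_def)
  have zS: "z \<in> S z" for z by (simp add: S_def)
  have bound: "cmod (\<Prod>x\<in>S z. - x) \<le> cmod z * (K * (1 + cmod z)) ^ (d - 1)" if "z \<notin> B" for z
  proof -
    have "1 * 1 \<le> K * (1 + cmod z)"
      using K by (intro mult_mono) auto
    then have "(\<Prod>x\<in>S z - {z}. cmod x) \<le> (K * (1 + cmod z)) ^ (d - 1)"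
      using card[OF that] zS[of z] finS[of z] K(2)
      by (intro prod_le_power) (auto simp: S_def)
    then have le: "cmod z * (\<Prod>x\<in>S z - {z}. cmod x) \<le> cmod z * (K * (1 + cmod z)) ^ (d - 1)"
      by (intro mult_left_mono) auto
    have "cmod (\<Prod>x\<in>S z. - x) = (\<Prod>x\<in>S z. cmod x)"
      by (simp flip: prod_norm)
    also have "\<dots> = cmod z * (\<Prod>x\<in>S z - {z}. cmod x)"
      by (rule prod.remove[OF finS zS])
    finally show ?thesis using le by simp
  qed
  \<comment> \<open>\<open>Q q\<close>: the product, off a finite set, can be written as a fraction with denominator \<open>q\<close>.
    A denominator of least degree is constant, because a zero of it is a zero of the numerator as well.\<close>
  define Q where "Q q \<longleftrightarrow> q \<noteq> 0 \<and> (\<exists>p B. finite B \<and> (\<forall>z. z \<notin> B \<longrightarrow> poly p z = poly q z * (\<Prod>x\<in>S z. - x)))" for q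
  have "Q q" using q B pq by (auto simp: Q_def)
  then obtain q1 where q1: "Q q1" and min: "\<And>q'. Q q' \<Longrightarrow> degree q1 \<le> degree q'"
    using ex_has_least_nat[of Q q degree] by metis
  then obtain p1 B1' where q1nz: "q1 \<noteq> 0" and B1': "finite B1'"
    and pq1': "\<And>z. z \<notin> B1' \<Longrightarrow> poly p1 z = poly q1 z * (\<Prod>x\<in>S z. - x)"
    unfolding Q_def by blast
  define B1 where "B1 = B \<union> B1'"
  have B1: "finite B1" using B B1' by (simp add: B1_def)
  have pq1: "poly p1 z = poly q1 z * (\<Prod>x\<in>S z. - x)" if "z \<notin> B1" for z
    using pq1' that by (simp add: B1_def)
  have le: "cmod (poly p1 z) \<le> cmod (poly q1 z) * (cmod z * (K * (1 + cmod z)) ^ (d - 1))" for z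
  proof (rule le_off_finite_imp_le[OF _ _ B1])
    fix z assume "z \<notin> B1"
    then show "cmod (poly p1 z) \<le> cmod (poly q1 z) * (cmod z * (K * (1 + cmod z)) ^ (d - 1))"
      using pq1 bound by (simp add: norm_mult B1_def mult_left_mono)
  qed (intro continuous_intros)+
  have "degree q1 = 0"
  proof (rule ccontr)
    assume "degree q1 \<noteq> 0"
    then obtain z0 where z0: "poly q1 z0 = 0"
      using fundamental_theorem_of_algebra[of q1] by (auto simp: constant_degree)
    then have "poly p1 z0 = 0"
      using le[of z0] by simp
    with z0 obtain p2 q2 where p2: "p1 = [:-z0, 1:] * p2" and q2: "q1 = [:-z0, 1:] * q2"
      unfolding poly_eq_0_iff_dvd by (auto elim!: dvdE)
    have "poly p2 z = poly q2 z * (\<Prod>x\<in>S z. - x)" if "z \<notin> insert z0 B1" for z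
    proof -
      have "(z - z0) * poly p2 z = (z - z0) * (poly q2 z * (\<Prod>x\<in>S z. - x))"
        using pq1[of z] that unfolding p2 q2 by (simp add: algebra_simps)
      then show ?thesis using that by simp
    qed
    moreover have "q2 \<noteq> 0" using q1nz q2 by auto
    ultimately have "Q q2"
      unfolding Q_def using B1 by (metis finite_insert)
    moreover have "degree q1 = Suc (degree q2)"
      using \<open>q2 \<noteq> 0\<close> unfolding q2 by (subst degree_mult_eq) auto
    ultimately show False using min by fastforce
  qed
  then obtain k where k: "q1 = [:k:]" "k \<noteq> 0"
    using q1nz by (metis degree_eq_zeroE pCons_0_0)
  define h where "h = smult (inverse k) p1"
  have h: "poly h z = (\<Prod>x\<in>S z. - x)" if "z \<notin> B1" for z
    using pq1[OF that] k by (simp add: h_def)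
  have hle: "cmod (poly h z) \<le> cmod z * (K * (1 + cmod z)) ^ (d - 1)" for z
  proof -
    have "cmod (poly h z) = cmod (poly p1 z) / cmod k"
      by (simp add: h_def norm_mult norm_inverse divide_inverse mult.commute)
    also have "\<dots> \<le> cmod z * (K * (1 + cmod z)) ^ (d - 1)"
      using le[of z] k by (simp add: pos_divide_le_eq mult.commute)
    finally show ?thesis .
  qed
  have d: "d \<ge> 1"
  proof -
    obtain z where "z \<notin> B"
      using B ex_new_if_finite infinite_UNIV_char_0 by blast
    then have "card (S z) = d" by (rule card)
    then show ?thesis
      using finS[of z] zS[of z] by (metis One_nat_def Suc_leI card_gt_0_iff empty_iff)
  qed
  have "degree h \<le> d"
  proof (rule degree_le_growth)
    fix z :: complex assume z: "cmod z \<ge> 1"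
    have "cmod (poly h z) \<le> cmod z * (K * (1 + cmod z)) ^ (d - 1)" by (rule hle)
    also have "\<dots> \<le> cmod z * (K * (2 * cmod z)) ^ (d - 1)"
      using z K(1) by (intro mult_left_mono power_mono) auto
    also have "\<dots> = (2 * K) ^ (d - 1) * cmod z ^ Suc (d - 1)"
      by (simp add: power_mult_distrib mult_ac)
    finally show "cmod (poly h z) \<le> (2 * K) ^ (d - 1) * cmod z ^ d"
      using d by simp
  qed
  define B2 where "B2 = {z. poly f z \<in> poly f ` B1}"
  have finB2: "finite B2"
    unfolding B2_def using f B1 by (intro finite_poly_vimage) auto
  have S2: "S z \<subseteq> {x. poly h x = poly h z}" if "z \<notin> B2" for z
  proof
    fix x assume x: "x \<in> S z"
    then have eq: "S x = S z" "poly f x = poly f z" by (auto simp: S_def)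
    have "poly f z \<notin> poly f ` B1" using that by (simp add: B2_def)
    then have "x \<notin> B1" "z \<notin> B1" using eq(2) by (metis imageI)+
    then show "x \<in> {x. poly h x = poly h z}"
      using h eq(1) by simp
  qed
  have deg: "degree h \<ge> 1"
  proof (rule ccontr)
    assume "\<not> degree h \<ge> 1"
    then obtain b where b: "h = [:b:]" by (metis degree_eq_zeroE less_one not_le)
    have "b = 0" using hle[of 0] b by simp
    have "poly f z = poly f 0" if "z \<notin> B1" for z
    proof -
      have "(\<Prod>x\<in>S z. - x) = 0" using h[OF that] b \<open>b = 0\<close> by simp
      then have "0 \<in> S z" using finS by auto
      then show ?thesis by (simp add: S_def)
    qed
    then have "UNIV \<subseteq> B1 \<union> {x. poly f x = poly f 0}" by blast
    then show False
      using B1 finite_fibre[OF f] infinite_UNIV_char_0 by (meson finite_UnI finite_subset)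
  qed
  have nz: "h - [:c:] \<noteq> 0" and degc: "degree (h - [:c:]) = degree h" for c
    using deg degree_diff_const[of h c] by auto
  have fin: "card {x. poly h x = poly h z} = degree h \<and> {x. poly h x = poly h z} = S z" if z: "z \<notin> B2" for z
  proof -
    have "z \<notin> B" using z by (auto simp: B2_def B1_def)
    then have cS: "card (S z) = d" by (rule card)
    have cle: "card {x. poly h x = poly h z} \<le> degree h"
      using card_roots_le_degree[OF nz[of "poly h z"], of "{x. poly h x = poly h z}"] degc by auto
    have "card (S z) \<le> card {x. poly h x = poly h z}"
      by (intro card_mono finite_fibre[OF deg] S2[OF z])
    with cS cle \<open>degree h \<le> d\<close> have eq: "card {x. poly h x = poly h z} = degree h" "card (S z) = card {x. poly h x = poly h z}"
      by linarith+
    then show ?thesis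
      using card_subset_eq[OF finite_fibre[OF deg] S2[OF z]] by simp
  qed
  show ?thesis
    by (rule that[OF deg finB2]) (use fin[unfolded S_def] in blast)+
qed

text \<open>
  If \<open>p\<close> takes the constant value \<open>c\<close> on a fibre \<open>h = y\<close> with \<open>deg h\<close> points, then
  \<open>h - y\<close> divides \<open>p - c\<close>, and the quotient is again constant on the fibres of \<open>h\<close> other than
  this one. This lowers the degree; the exceptional set \<open>E\<close> grows along the induction.
\<close>
lemma pcompose_if_constant_on_fibres:
  fixes h p :: "complex poly"
  assumes h: "degree h \<ge> 1" and E: "finite E"
    and card: "\<And>y. y \<notin> E \<Longrightarrow> card {x. poly h x = y} = degree h"
    and const: "\<And>x x'. poly h x = poly h x' \<Longrightarrow> poly h x \<notin> E \<Longrightarrow> poly p x = poly p x'"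
  shows "\<exists>p'. p = pcompose p' h"
  using E card const
proof (induction "degree p" arbitrary: p E rule: less_induct)
  case less
  obtain y where y: "y \<notin> E"
    using less.prems(1) ex_new_if_finite infinite_UNIV_char_0 by blast
  define X where "X = {x. poly h x = y}"
  have cardX: "card X = degree h"
    unfolding X_def by (rule less.prems(2)[OF y])
  then have "X \<noteq> {}" using h by force
  then obtain x0 where x0: "poly h x0 = y" by (auto simp: X_def)
  define c where "c = poly p x0"
  define r where "r = h - [:y:]"
  have degr: "degree r = degree h"
    unfolding r_def by (rule degree_diff_const)
  then have "r \<noteq> 0" using h by auto
  have px: "poly p x = c" if "x \<in> X" for x
    using less.prems(3)[of x x0] that x0 y by (simp add: X_def c_def)
  have "(p - [:c:]) mod r = 0"
  proof (rule ccontr)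
    assume nz: "(p - [:c:]) mod r \<noteq> 0"
    have "poly ((p - [:c:]) mod r) x = 0" if "x \<in> X" for x
    proof -
      have "poly r x = 0" using that by (simp add: r_def X_def)
      moreover have "(p - [:c:]) mod r = (p - [:c:]) - (p - [:c:]) div r * r"
        by (rule minus_div_mult_eq_mod[symmetric])
      then have "poly ((p - [:c:]) mod r) x = poly p x - c - poly ((p - [:c:]) div r) x * poly r x"
        by (simp only: poly_diff poly_mult) simp
      ultimately show ?thesis using px[OF that] by simp
    qed
    then have "card X \<le> degree ((p - [:c:]) mod r)"
      by (intro card_roots_le_degree[OF nz]) auto
    also have "\<dots> < degree r"
      using degree_mod_less'[OF \<open>r \<noteq> 0\<close> nz] .
    finally show False using cardX degr by simp
  qed
  then obtain p1 where p1: "p - [:c:] = r * p1"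
    by (auto elim: dvdE simp: mod_eq_0_iff_dvd)
  show ?case
  proof (cases "p1 = 0")
    case True
    then have "p = pcompose [:c:] h" using p1 by simp
    then show ?thesis by blast
  next
    case False
    have card': "card {x. poly h x = y'} = degree h" if "y' \<notin> insert y E" for y'
      using less.prems(2) that by blast
    have "degree r + degree p1 = degree (p - [:c:])"
      using False \<open>r \<noteq> 0\<close> p1 by (simp add: degree_mult_eq)
    also have "\<dots> \<le> degree p"
      by (rule degree_diff_le) auto
    finally have deg: "degree p1 < degree p" using degr h by linarith
    have const': "poly p1 x = poly p1 x'" if "poly h x = poly h x'" "poly h x \<notin> insert y E" for x x'
    proof -
      have "(poly h x - y) * poly p1 x = (poly h x - y) * poly p1 x'"
        using arg_cong[OF p1, of "\<lambda>P. poly P x"] arg_cong[OF p1, of "\<lambda>P. poly P x'"]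
          less.prems(3)[of x x'] that by (simp add: r_def)
      then show ?thesis using that by simp
    qed
    obtain p1' where p1': "p1 = pcompose p1' h"
      using less.hyps[OF deg _ card' const'] less.prems(1) by blast
    then have "p = pcompose ([:c:] + [:-y, 1:] * p1') h"
      using p1 unfolding p1'[symmetric] pcompose_add pcompose_mult
      by (simp add: pcompose_pCons r_def algebra_simps)
    then show ?thesis by blast
  qed
qed

text \<open>
  Lueroth's theorem for the field \<open>\<complex>(f, g)\<close>, in the following form: that its generator \<open>h\<close> is a
  rational function of \<open>f\<close> and \<open>g\<close> is only recorded as the fact that \<open>f\<close> and \<open>g\<close>
  together separate points at least as well as \<open>h\<close> does, off a finite set.
\<close>
lemma common_right_factor:
  fixes f g :: "complex poly"
  assumes f: "degree f \<ge> 1"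
  obtains f' g' h B where "f = pcompose f' h" "g = pcompose g' h" "finite B"
    "\<And>z x. z \<notin> B \<Longrightarrow> poly f x = poly f z \<Longrightarrow> poly g x = poly g z \<Longrightarrow> poly h x = poly h z"
proof -
  obtain h B where h: "degree h \<ge> 1" and B: "finite B"
    and fib: "\<And>z. z \<notin> B \<Longrightarrow> {x. poly h x = poly h z} = {x. poly f x = poly f z \<and> poly g x = poly g z}"
    and card: "\<And>z. z \<notin> B \<Longrightarrow> card {x. poly h x = poly h z} = degree h"
    by (rule generic_common_fibre[OF f, where g = g]) (rule that, assumption+)
  define E where "E = poly h ` B"
  have E: "finite E" using B by (simp add: E_def)
  have "\<exists>z. poly h z = y" for y
    using surj_poly[OF h] by (metis surjD)
  then have cardE: "card {x. poly h x = y} = degree h" if "y \<notin> E" for y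
    using card that unfolding E_def by (metis imageI)
  have "poly f x = poly f x' \<and> poly g x = poly g x'" if "poly h x = poly h x'" "poly h x \<notin> E" for x x'
    using fib[of x'] that by (auto simp: E_def)
  then obtain f' g' where "f = pcompose f' h" "g = pcompose g' h"
    using pcompose_if_constant_on_fibres[OF h E cardE] by metis
  moreover have "poly h x = poly h z" if "z \<notin> B" "poly f x = poly f z" "poly g x = poly g z" for x z
    using fib[OF that(1)] that(2,3) by blast
  ultimately show ?thesis using that B by blast
qed

section \<open>Vanishing displacement and power sums\<close>

text \<open>
  By linearity the hypothesis extends from powers to all polynomials, in particular to one that vanishes
  at every \<open>x i\<close> other than \<open>y\<close>.
\<close>
lemma grouped_weights_eq_0:
  fixes x c :: "'i \<Rightarrow> complex"
  assumes I: "finite I" and van: "\<And>k. (\<Sum>i\<in>I. c i * x i ^ k) = 0"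
  shows "(\<Sum>i | i \<in> I \<and> x i = y. c i) = 0"
proof -
  have poly_van: "(\<Sum>i\<in>I. c i * poly p (x i)) = 0" for p
  proof -
    have "(\<Sum>i\<in>I. c i * poly p (x i)) = (\<Sum>k\<le>degree p. coeff p k * (\<Sum>i\<in>I. c i * x i ^ k))"
      by (simp add: poly_altdef sum_distrib_left mult_ac) (rule sum.swap)
    then show ?thesis by (simp add: van)
  qed
  define p where "p = (\<Prod>v\<in>x ` I - {y}. [:-v, 1:])"
  have p0: "poly p v = 0" if "v \<in> x ` I" "v \<noteq> y" for v
    using that I by (auto simp: p_def poly_prod)
  have py: "poly p y \<noteq> 0"
    using I by (auto simp: p_def poly_prod)
  have "0 = (\<Sum>i\<in>I. c i * poly p (x i))"
    by (simp add: poly_van)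
  also have "\<dots> = (\<Sum>i | i \<in> I \<and> x i = y. c i * poly p (x i))"
    using I p0 by (intro sum.mono_neutral_right) auto
  also have "\<dots> = (\<Sum>i | i \<in> I \<and> x i = y. c i) * poly p y"
    by (simp add: sum_distrib_right)
  finally show ?thesis using py by simp
qed

text \<open>
  The transport equation \<open>\<partial>\<^sub>\<epsilon> z = - g(z) \<partial>\<^sub>t z\<close> for a branch of \<open>(f + \<epsilon> g)(z) = t\<close>. With
  \<open>P = (f + \<epsilon> g)'(z)\<close>, differentiating in \<open>t\<close> and in \<open>\<epsilon>\<close> gives
  \<open>P \<partial>\<^sub>t z = 1\<close> and \<open>P \<partial>\<^sub>\<epsilon> z = - g(z)\<close>.
\<close>
lemma deformed_branch_derivatives:
  fixes f g :: "complex poly"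
  assumes Z: "analytic2_on Z U (ball 0 \<delta>)" and U: "open U"
    and eq: "\<And>t \<epsilon>. t \<in> U \<Longrightarrow> \<epsilon> \<in> ball 0 \<delta> \<Longrightarrow> poly (f + smult \<epsilon> g) (Z t \<epsilon>) = t"
    and t: "t \<in> U" and \<epsilon>: "\<epsilon> \<in> ball 0 \<delta>"
  obtains D where "((\<lambda>t. Z t \<epsilon>) has_field_derivative D) (at t)"
    "((\<lambda>\<epsilon>. Z t \<epsilon>) has_field_derivative - poly g (Z t \<epsilon>) * D) (at \<epsilon>)"
proof -
  have "(\<lambda>t. Z t \<epsilon>) holomorphic_on U" "(\<lambda>\<epsilon>. Z t \<epsilon>) holomorphic_on ball 0 \<delta>"
    using Z t \<epsilon> by (auto simp: analytic2_on_def)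
  then obtain Dt De where Dt: "((\<lambda>t. Z t \<epsilon>) has_field_derivative Dt) (at t)"
      and De: "((\<lambda>\<epsilon>. Z t \<epsilon>) has_field_derivative De) (at \<epsilon>)"
    using U t \<epsilon> holomorphic_derivI[of _ U t] holomorphic_derivI[of _ "ball 0 \<delta>" \<epsilon>] open_ball by blast
  define P where "P = poly (pderiv f) (Z t \<epsilon>) + \<epsilon> * poly (pderiv g) (Z t \<epsilon>)"
  have "((\<lambda>t. poly f (Z t \<epsilon>) + \<epsilon> * poly g (Z t \<epsilon>)) has_field_derivative P * Dt) (at t)"
    unfolding P_def by (auto intro!: derivative_eq_intros Dt simp: algebra_simps)
  then have "((\<lambda>t. t) has_field_derivative P * Dt) (at t)"
    by (rule has_field_derivative_transform_within_open[OF _ U t]) (use eq \<epsilon> in simp)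
  then have 1: "P * Dt = 1"
    using DERIV_unique DERIV_ident by blast
  have "((\<lambda>\<epsilon>. poly f (Z t \<epsilon>) + \<epsilon> * poly g (Z t \<epsilon>)) has_field_derivative P * De + poly g (Z t \<epsilon>)) (at \<epsilon>)"
    unfolding P_def by (auto intro!: derivative_eq_intros De simp: algebra_simps)
  then have "((\<lambda>_. t) has_field_derivative P * De + poly g (Z t \<epsilon>)) (at \<epsilon>)"
    by (rule has_field_derivative_transform_within_open[OF _ open_ball \<epsilon>]) (use eq t in simp)
  then have "P * De + poly g (Z t \<epsilon>) = 0"
    using DERIV_unique DERIV_const by blast
  then have "P * De = - poly g (Z t \<epsilon>)"
    by (simp add: add_eq_0_iff)
  then have "De = - poly g (Z t \<epsilon>) * Dt"
    using 1 by (metis mult.commute mult.left_commute mult_1)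
  then show ?thesis using that Dt De by blast
qed

lemma has_field_derivative_weighted_power_sum:
  fixes g :: "complex poly"
  assumes "\<And>i. i \<in> I \<Longrightarrow> (w i has_field_derivative D i) (at x)"
  shows "((\<lambda>s. \<Sum>i\<in>I. n i * poly g (w i s) ^ Suc k) has_field_derivative
           of_nat (Suc k) * (\<Sum>i\<in>I. n i * (poly g (w i x) ^ k * (poly (pderiv g) (w i x) * D i)))) (at x)"
proof -
  have "((\<lambda>s. n i * poly g (w i s) ^ Suc k) has_field_derivative
           of_nat (Suc k) * (n i * (poly g (w i x) ^ k * (poly (pderiv g) (w i x) * D i)))) (at x)"
    if "i \<in> I" for i
    by (rule DERIV_cong[OF DERIV_cmult[OF DERIV_power_Suc[OF has_field_derivative_poly[OF assms[OF that]]]]])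
      (simp add: mult_ac)
  then show ?thesis
    unfolding sum_distrib_left by (rule DERIV_sum)
qed

text \<open>
  By the transport equation the \<open>\<epsilon>\<close>-derivative of the \<open>k\<close>-th power sum and the
  \<open>t\<close>-derivative of the next one are multiples of the same expression, called \<open>s\<close> below. So the
  vanishing of one power sum on the whole domain makes the next one constant in \<open>t\<close>, and constant
  sums over branches vanish.
\<close>
lemma power_sums_eq_0_if_displacement_eq_0:
  fixes f g :: "complex poly"
  assumes U: "open U" "connected U" "U \<noteq> {}" and \<delta>: "\<delta> > 0" and I: "finite I"
    and Z: "\<And>i. i \<in> I \<Longrightarrow> analytic2_on (Z i) U (ball 0 \<delta>)"
    and eq: "\<And>i t \<epsilon>. i \<in> I \<Longrightarrow> t \<in> U \<Longrightarrow> \<epsilon> \<in> ball 0 \<delta> \<Longrightarrow> poly (f + smult \<epsilon> g) (Z i t \<epsilon>) = t"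
    and n: "(\<Sum>i\<in>I. n i) = 0"
    and disp: "\<And>t \<epsilon>. t \<in> U \<Longrightarrow> \<epsilon> \<in> ball 0 \<delta> \<Longrightarrow> (\<Sum>i\<in>I. n i * poly f (Z i t \<epsilon>)) = 0"
    and t: "t \<in> U" and \<epsilon>: "\<epsilon> \<in> ball 0 \<delta>"
  shows "(\<Sum>i\<in>I. n i * poly g (Z i t \<epsilon>) ^ k) = 0"
proof (cases k)
  case 0
  then show ?thesis using n by simp
next
  case (Suc k')
  have holt: "(\<lambda>t. Z i t \<epsilon>) holomorphic_on U" if "i \<in> I" "\<epsilon> \<in> ball 0 \<delta>" for i \<epsilon>
    using Z that by (auto simp: analytic2_on_def)
  have hole: "(\<lambda>\<epsilon>. Z i t \<epsilon>) holomorphic_on ball 0 \<delta>" if "i \<in> I" "t \<in> U" for i t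
    using Z that by (auto simp: analytic2_on_def)
  from t \<epsilon> have "(\<Sum>i\<in>I. n i * poly g (Z i t \<epsilon>) ^ Suc k') = 0"
  proof (induction k' arbitrary: t \<epsilon>)
    case 0
    have "(\<Sum>i\<in>I. n i * poly g (Z i t \<epsilon>)) = 0"
    proof (rule analytic_continuation_open[of "ball 0 \<delta> - {0}" "ball 0 \<delta>" "\<lambda>\<epsilon>. \<Sum>i\<in>I. n i * poly g (Z i t \<epsilon>)" "\<lambda>_. 0"])
      show "(\<lambda>\<epsilon>. \<Sum>i\<in>I. n i * poly g (Z i t \<epsilon>)) holomorphic_on ball 0 \<delta>"
        by (intro holomorphic_intros hole 0)
      have "complex_of_real (\<delta> / 2) \<in> ball 0 \<delta> - {0}"
        using \<delta> by simp
      then show "ball (0::complex) \<delta> - {0} \<noteq> {}" by blast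
      fix \<epsilon> assume \<epsilon>: "\<epsilon> \<in> ball (0::complex) \<delta> - {0}"
      have "\<epsilon> * (\<Sum>i\<in>I. n i * poly g (Z i t \<epsilon>)) = (\<Sum>i\<in>I. n i * (\<epsilon> * poly g (Z i t \<epsilon>)))"
        by (simp add: sum_distrib_left mult_ac)
      also have "\<dots> = (\<Sum>i\<in>I. n i * (t - poly f (Z i t \<epsilon>)))"
      proof (rule sum.cong)
        fix i assume "i \<in> I"
        from eq[OF this 0(1), of \<epsilon>] \<epsilon>
        have "\<epsilon> * poly g (Z i t \<epsilon>) = t - poly f (Z i t \<epsilon>)"
          by (simp add: algebra_simps)
        then show "n i * (\<epsilon> * poly g (Z i t \<epsilon>)) = n i * (t - poly f (Z i t \<epsilon>))" by simp
      qed simp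
      also have "\<dots> = (\<Sum>i\<in>I. n i) * t - (\<Sum>i\<in>I. n i * poly f (Z i t \<epsilon>))"
        by (simp add: right_diff_distrib sum_subtractf sum_distrib_right)
      also have "\<dots> = 0"
        using n disp[OF 0(1)] \<epsilon> by simp
      finally show "(\<Sum>i\<in>I. n i * poly g (Z i t \<epsilon>)) = 0"
        using \<epsilon> by simp
    qed (use 0 in auto)
    then show ?case by simp
  next
    case (Suc k)
    have der0: "((\<lambda>t. \<Sum>i\<in>I. n i * poly g (Z i t \<epsilon>) ^ Suc (Suc k)) has_field_derivative 0) (at t)"
      if t: "t \<in> U" for t
    proof -
      have "\<exists>D. ((\<lambda>t. Z i t \<epsilon>) has_field_derivative D) (at t) \<and>
               ((\<lambda>\<epsilon>. Z i t \<epsilon>) has_field_derivative - poly g (Z i t \<epsilon>) * D) (at \<epsilon>)" if i: "i \<in> I" for i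
        using deformed_branch_derivatives[OF Z[OF i] U(1) eq[OF i] t Suc.prems(2)] by metis
      then obtain D where D: "\<And>i. i \<in> I \<Longrightarrow> ((\<lambda>t. Z i t \<epsilon>) has_field_derivative D i) (at t)"
        "\<And>i. i \<in> I \<Longrightarrow> ((\<lambda>\<epsilon>. Z i t \<epsilon>) has_field_derivative - poly g (Z i t \<epsilon>) * D i) (at \<epsilon>)"
        by metis
      define s where "s = (\<Sum>i\<in>I. n i * (poly g (Z i t \<epsilon>) ^ Suc k * (poly (pderiv g) (Z i t \<epsilon>) * D i)))"
      have neg: "(\<Sum>i\<in>I. n i * (poly g (Z i t \<epsilon>) ^ k * (poly (pderiv g) (Z i t \<epsilon>) * (- poly g (Z i t \<epsilon>) * D i)))) = - s"
        unfolding s_def sum_negf[symmetric] by (intro sum.cong) (simp_all add: mult_ac)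
      have "((\<lambda>\<epsilon>. \<Sum>i\<in>I. n i * poly g (Z i t \<epsilon>) ^ Suc k) has_field_derivative of_nat (Suc k) * - s) (at \<epsilon>)"
        unfolding neg[symmetric] by (rule has_field_derivative_weighted_power_sum) (rule D(2))
      then have "((\<lambda>_. 0) has_field_derivative of_nat (Suc k) * - s) (at \<epsilon>)"
        by (rule has_field_derivative_transform_within_open[OF _ open_ball Suc.prems(2)])
           (rule Suc.IH[OF t])
      then have "of_nat (Suc k) * - s = 0"
        using DERIV_unique DERIV_const by blast
      then have s: "s = 0"
        by (simp del: of_nat_Suc)
      have "((\<lambda>t. \<Sum>i\<in>I. n i * poly g (Z i t \<epsilon>) ^ Suc (Suc k)) has_field_derivative of_nat (Suc (Suc k)) * s) (at t)"
        unfolding s_def by (rule has_field_derivative_weighted_power_sum) (rule D(1))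
      then show ?thesis by (simp only: s mult_zero_right)
    qed
    obtain c where c: "\<And>t. t \<in> U \<Longrightarrow> (\<Sum>i\<in>I. n i * poly g (Z i t \<epsilon>) ^ Suc (Suc k)) = c"
    proof (rule DERIV_zero_connected_constant[OF U(2,1) finite.emptyI])
      show "continuous_on U (\<lambda>t. \<Sum>i\<in>I. n i * poly g (Z i t \<epsilon>) ^ Suc (Suc k))"
        using der0 by (meson DERIV_isCont continuous_at_imp_continuous_on)
      show "\<forall>x\<in>U - {}. ((\<lambda>t. \<Sum>i\<in>I. n i * poly g (Z i t \<epsilon>) ^ Suc (Suc k)) has_field_derivative 0) (at x)"
        using der0 by blast
    qed blast
    have "c = 0"
    proof (rule constant_weighted_sum_of_branches_eq_0[where F = "f + smult \<epsilon> g" and U = U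
            and I = I and z = "\<lambda>i t. Z i t \<epsilon>" and n = n and G = "g ^ Suc (Suc k)"])
      show "(\<Sum>i\<in>I. n i * poly (g ^ Suc (Suc k)) (Z i t \<epsilon>)) = c" if "t \<in> U" for t
        using c[OF that] by (simp only: poly_power)
    qed (use U I holt Suc.prems(2) eq n in auto)
    then show ?case using c Suc.prems(1) by blast
  qed
  then show ?thesis using Suc by simp
qed

section \<open>Infinitesimal centers and the composition condition\<close>

text \<open>
  Two functions that agree at a single point need not agree identically, but finitely many functions have a
  common point, outside any given finite set, at which all coincidences are identities: some pattern of
  coincidences occurs on an infinite subset of a compact disc, hence on a set with a limit point.
\<close>
lemma generic_point_for_identities:
  fixes w :: "'i \<Rightarrow> complex \<Rightarrow> complex"
  assumes U: "open U" "connected U" "U \<noteq> {}" and I: "finite I" and E: "finite E"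
    and w: "\<And>i. i \<in> I \<Longrightarrow> w i holomorphic_on U"
  obtains s where "s \<in> U" "s \<notin> E"
    "\<And>i j t. i \<in> I \<Longrightarrow> j \<in> I \<Longrightarrow> w i s = w j s \<Longrightarrow> t \<in> U \<Longrightarrow> w i t = w j t"
proof -
  define C where "C t = {p \<in> I \<times> I. w (fst p) t = w (snd p) t}" for t
  obtain u e where e: "e > 0" "cball u e \<subseteq> U"
    using U by (meson ex_in_conv open_contains_cball)
  have "infinite (ball u e)"
    using e(1) by (metis centre_in_ball empty_iff finite_imp_not_open open_ball)
  then have "infinite (cball u e - E)"
    using E by (meson Diff_infinite_finite ball_subset_cball finite_subset)
  moreover have "finite (C ` (cball u e - E))"
    by (rule finite_subset[of _ "Pow (I \<times> I)"]) (use I in \<open>auto simp: C_def\<close>)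
  ultimately obtain s where s: "s \<in> cball u e - E" and inf: "infinite {t \<in> cball u e - E. C t = C s}" (is "infinite ?A")
    using pigeonhole_infinite by blast
  obtain \<xi> where \<xi>: "\<xi> \<in> cball u e" "\<xi> islimpt ?A"
    using inf compact_cball[of u e] unfolding compact_eq_Bolzano_Weierstrass
    by (metis (no_types, lifting) DiffD1 mem_Collect_eq subsetI)
  show ?thesis
  proof
    fix i j t assume ij: "i \<in> I" "j \<in> I" "w i s = w j s" and t: "t \<in> U"
    have "w i t - w j t = 0"
    proof (rule analytic_continuation[of "\<lambda>t. w i t - w j t" U ?A \<xi>])
      show "(\<lambda>t. w i t - w j t) holomorphic_on U"
        by (intro holomorphic_intros w ij)
      fix t assume "t \<in> ?A"
      then have "(i, j) \<in> C t" using ij by (auto simp: C_def)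
      then show "w i t - w j t = 0" by (simp add: C_def)
    qed (use U e \<xi> t in auto)
    then show "w i t = w j t" by simp
  qed (use s e in auto)
qed

theorem theorem1:
  fixes f g :: "complex poly" and t0 :: complex and a :: "nat \<Rightarrow> complex" and n :: "nat \<Rightarrow> int"
  assumes "degree f \<ge> 1"
    and "zero_cycle f t0 a n"
  shows "infinitesimal_center f g t0 a n \<longleftrightarrow> composition_condition f g t0 a n"
proof
  let ?I = "{1..degree f}"
  assume center: "infinitesimal_center f g t0 a n"
  obtain f' g' h B where fh: "f = pcompose f' h" and gh: "g = pcompose g' h" and B: "finite B"
    and sep: "\<And>z x. z \<notin> B \<Longrightarrow> poly f x = poly f z \<Longrightarrow> poly g x = poly g z \<Longrightarrow> poly h x = poly h z"
    using common_right_factor[OF assms(1), of g] by metis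
  have "(\<Sum>j | j \<in> ?I \<and> (\<forall>t\<in>U. poly h (Z j t \<epsilon>) = poly h (Z i t \<epsilon>)). n j) = 0"
    if def: "deformed_branches f g t0 a U \<delta> Z" and \<epsilon>: "\<epsilon> \<in> ball 0 \<delta>" and i: "i \<in> ?I"
    for U \<delta> Z \<epsilon> i
  proof -
    have \<delta>: "\<delta> > 0" and U: "open U" "connected U" "U \<noteq> {}"
      and Z: "\<And>j. j \<in> ?I \<Longrightarrow> analytic2_on (Z j) U (ball 0 \<delta>)"
      and eq: "\<And>j t \<epsilon>. j \<in> ?I \<Longrightarrow> t \<in> U \<Longrightarrow> \<epsilon> \<in> ball 0 \<delta> \<Longrightarrow> poly (f + smult \<epsilon> g) (Z j t \<epsilon>) = t"
      using def by (auto simp: deformed_branches_def root_branches_def)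
    have disp: "(\<Sum>j\<in>?I. of_int (n j) * poly f (Z j t \<epsilon>)) = 0" if "t \<in> U" "\<epsilon> \<in> ball 0 \<delta>" for t \<epsilon>
      using center def that by (auto simp: infinitesimal_center_def displacement_def)
    have "(\<Sum>j\<in>?I. of_int (n j)) = (of_int (\<Sum>j\<in>?I. n j) :: complex)" by simp
    also have "\<dots> = 0" using assms(2) by (simp add: zero_cycle_def)
    finally have n0: "(\<Sum>j\<in>?I. of_int (n j)) = (0 :: complex)" .
    have hol: "(\<lambda>t. poly h (Z j t \<epsilon>)) holomorphic_on U" if "j \<in> ?I" for j
      using Z[OF that] \<epsilon> by (intro holomorphic_intros) (auto simp: analytic2_on_def)
    obtain s where s: "s \<in> U" "s \<notin> poly (f + smult \<epsilon> g) ` B"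
      and gen: "\<And>i j t. i \<in> ?I \<Longrightarrow> j \<in> ?I \<Longrightarrow> poly h (Z i s \<epsilon>) = poly h (Z j s \<epsilon>) \<Longrightarrow> t \<in> U \<Longrightarrow>
              poly h (Z i t \<epsilon>) = poly h (Z j t \<epsilon>)"
      using generic_point_for_identities[where I = ?I and w = "\<lambda>j t. poly h (Z j t \<epsilon>)",
        OF U _ finite_imageI[OF B] hol] by (metis finite_atLeastAtMost)
    \<comment> \<open>At a generic point \<open>s\<close> the grouping by \<open>h\<close> as functions is the grouping by values of \<open>g\<close>.\<close>
    have same: "(\<forall>t\<in>U. poly h (Z j t \<epsilon>) = poly h (Z i t \<epsilon>)) \<longleftrightarrow> poly g (Z j s \<epsilon>) = poly g (Z i s \<epsilon>)"
      if j: "j \<in> ?I" for j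
    proof
      assume "\<forall>t\<in>U. poly h (Z j t \<epsilon>) = poly h (Z i t \<epsilon>)"
      then show "poly g (Z j s \<epsilon>) = poly g (Z i s \<epsilon>)"
        using s(1) by (simp add: gh poly_pcompose)
    next
      assume g: "poly g (Z j s \<epsilon>) = poly g (Z i s \<epsilon>)"
      have "Z i s \<epsilon> \<notin> B"
        using s(2) eq[OF i s(1) \<epsilon>] by (metis imageI)
      moreover have "poly f (Z j s \<epsilon>) = poly f (Z i s \<epsilon>)"
        using eq[OF j s(1) \<epsilon>] eq[OF i s(1) \<epsilon>] g by (simp flip: eq_diff_eq)
      ultimately have "poly h (Z j s \<epsilon>) = poly h (Z i s \<epsilon>)"
        using sep g by blast
      then show "\<forall>t\<in>U. poly h (Z j t \<epsilon>) = poly h (Z i t \<epsilon>)"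
        using gen[OF j i] by blast
    qed
    have "(\<Sum>j | j \<in> ?I \<and> poly g (Z j s \<epsilon>) = poly g (Z i s \<epsilon>). of_int (n j)) = (0 :: complex)"
    proof (rule grouped_weights_eq_0)
      show "(\<Sum>j\<in>?I. of_int (n j) * poly g (Z j s \<epsilon>) ^ k) = 0" for k
        using U \<delta> finite_atLeastAtMost Z eq n0 disp s(1) \<epsilon> by (rule power_sums_eq_0_if_displacement_eq_0)
    qed simp
    then have "(\<Sum>j | j \<in> ?I \<and> poly g (Z j s \<epsilon>) = poly g (Z i s \<epsilon>). n j) = 0"
      by (simp only: of_int_sum[symmetric] of_int_eq_0_iff)
    also have "{j. j \<in> ?I \<and> poly g (Z j s \<epsilon>) = poly g (Z i s \<epsilon>)} =
        {j. j \<in> ?I \<and> (\<forall>t\<in>U. poly h (Z j t \<epsilon>) = poly h (Z i t \<epsilon>))}"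
      using same by blast
    finally show ?thesis .
  qed
  then show "composition_condition f g t0 a n"
    unfolding composition_condition_def using fh gh by blast
next
  let ?I = "{1..degree f}"
  assume "composition_condition f g t0 a n"
  then obtain f' g' h where fh: "f = pcompose f' h"
    and comp: "\<And>U \<delta> Z \<epsilon> i. deformed_branches f g t0 a U \<delta> Z \<Longrightarrow> \<epsilon> \<in> ball 0 \<delta> \<Longrightarrow> i \<in> ?I \<Longrightarrow>
       (\<Sum>j | j \<in> ?I \<and> (\<forall>t\<in>U. poly h (Z j t \<epsilon>) = poly h (Z i t \<epsilon>)). n j) = 0"
    unfolding composition_condition_def by blast
  show "infinitesimal_center f g t0 a n"
    unfolding infinitesimal_center_def
  proof (intro allI impI ballI)
    fix U \<delta> Z t \<epsilon>
    assume def: "deformed_branches f g t0 a U \<delta> Z" and t: "t \<in> U" and \<epsilon>: "\<epsilon> \<in> ball (0::complex) \<delta>"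
    \<comment> \<open>Restricting to \<open>U\<close> turns agreement on \<open>U\<close> into equality, so that the sum can be grouped by \<open>v\<close>.\<close>
    define v where "v j = restrict (\<lambda>t. poly h (Z j t \<epsilon>)) U" for j
    have v: "v j = v i \<longleftrightarrow> (\<forall>t\<in>U. poly h (Z j t \<epsilon>) = poly h (Z i t \<epsilon>))" for i j
      by (auto simp: v_def restrict_def fun_eq_iff)
    have "poly f x = poly f' (poly h x)" for x
      by (simp add: fh poly_pcompose)
    then have "displacement f n Z t \<epsilon> = (\<Sum>j\<in>?I. of_int (n j) * poly f' (v j t))"
      using t unfolding displacement_def by (simp add: v_def)
    also have "\<dots> = (\<Sum>u\<in>v ` ?I. \<Sum>j | j \<in> ?I \<and> v j = u. of_int (n j) * poly f' (v j t))"
      by (rule sum.image_gen) simp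
    also have "\<dots> = (\<Sum>u\<in>v ` ?I. of_int (\<Sum>j | j \<in> ?I \<and> v j = u. n j) * poly f' (u t))"
      by (intro sum.cong) (auto simp: sum_distrib_right)
    also have "\<dots> = 0"
      using comp[OF def \<epsilon>] by (intro sum.neutral) (auto simp: v simp del: of_int_sum)
    finally show "displacement f n Z t \<epsilon> = 0" .
  qed
qed

end
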